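(* Each $Q$-key (respectively, nonzero $Q$-atom) polynomial $\kappa^{\mathsf Q}_{w,\mu}$ (respectively, $\overline\kappa^{\mathsf Q}_{w,\mu}$), with $w\in S_\infty$ and $\mu$ a strict partition, occurs as $\kappa^{\mathsf Q}_\alpha$ (respectively, $\overline\kappa^{\mathsf Q}_\alpha$) for some symmetric weak composition $\alpha$. Each $P$-key (respectively, nonzero $P$-atom) polynomial $\kappa^{\mathsf P}_{w,\mu}$ (respectively, $\overline\kappa^{\mathsf P}_{w,\mu}$), with $w\in S_\infty$ and $\mu$ a strict partition, occurs as $\kappa^{\mathsf P}_\alpha$ (respectively, $\overline\kappa^{\mathsf P}_\alpha$) for some skew-symmetric weak composition $\alpha$.
   Context: Let $\mathbb P=\{1,2,3,\dots\}$. $S_\infty$ is the group of permutations of $\mathbb P$ generated by $s_i=(i\;\,i+1)$; it acts on $\mathbb Z[x_1,x_2,\dots]$ by permuting variables. Define $\pi_i f=(x_if-x_{i+1}s_if)/(x_i-x_{i+1})$ and $\overline\pi_i=\pi_i-1$. These satisfy the braid relations, so $\pi_w=\pi_{i_1}\cdots\pi_{i_l}$ and $\overline\pi_w=\overline\pi_{i_1}\cdots\overline\pi_{i_l}$ are well-defined for any reduced word $i_1\cdots i_l$ of $w\in S_\infty$. A weak composition is a sequence $\alpha=(\alpha_1,\alpha_2,\dots)$ of nonnegative integers with finite sum. A partition is a weakly decreasing weak composition; it is strict if its nonzero parts are distinct. $S_\infty$ acts by $w\alpha=(\alpha_{w^{-1}(1)},\alpha_{w^{-1}(2)},\dots)$.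 Let $\lambda(\alpha)$ be the partition sorting $\alpha$ and $u(\alpha)$ the minimal-length $u\in S_\infty$ with $\alpha=u\lambda(\alpha)$. Let $\mathsf D_\mu=\{(i,j)\in\mathbb P\times\mathbb P:1\le j\le\mu_i\}$. For $w\in S_\infty$ and strict $\mu$, let $p_\mu=\prod_{(i,j)\in\mathsf D_\mu}(x_i+x_{i+j})$ and $q_\mu=\prod_{(i,j)\in\mathsf D_\mu}(x_i+x_{i+j-1})$, and set $\kappa^{\mathsf P}_{w,\mu}=\pi_wp_\mu$, $\overline\kappa^{\mathsf P}_{w,\mu}=\overline\pi_wp_\mu$, $\kappa^{\mathsf Q}_{w,\mu}=\pi_wq_\mu$, $\overline\kappa^{\mathsf Q}_{w,\mu}=\overline\pi_wq_\mu$ (the $P$-key, $P$-atom, $Q$-key, $Q$-atom polynomials). A partition $\lambda$ is symmetric if $\lambda=\lambda^{\mathsf T}$; a weak composition $\alpha$ is symmetric if $\lambda(\alpha)$ is. For a symmetric partition $\lambda$, $\mathrm{half}_<(\lambda)$ and $\mathrm{half}_\le(\lambda)$ are the strict partitions with nonzero parts $\{\lambda_i-i:i\in\mathbb P\}\cap\mathbb P$ and $\{\lambda_i-(i-1):i\in\mathbb P\}\cap\mathbb P$. For a symmetric weak composition $\alpha$ with $u=u(\alpha)$, $\lambda=\lambda(\alpha)$: $\kappa^{\mathsf P}_\alpha=\kappa^{\mathsf P}_{u,\mathrm{half}_<(\lambda)}$, $\overline\kappa^{\mathsf P}_\alpha=\overline\kappa^{\mathsf P}_{u,\mathrm{half}_<(\lambda)}$,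 $\kappa^{\mathsf Q}_\alpha=\kappa^{\mathsf Q}_{u,\mathrm{half}_\le(\lambda)}$, $\overline\kappa^{\mathsf Q}_\alpha=\overline\kappa^{\mathsf Q}_{u,\mathrm{half}_\le(\lambda)}$. An addable (removable) corner of a partition is a cell that can be added to (removed from) its Young diagram so that the result is again the Young diagram of a partition. A partition $\lambda$ is skew-symmetric if $\lambda=\lambda^{\mathsf T}$ and, for every $i$: if $(i,i)$ is a removable corner then $(i,i+1)$ is not an addable corner, and if $(i,i)$ is an addable corner then $(i,i-1)$ is not a removable corner. A weak composition $\alpha$ is skew-symmetric if $\lambda(\alpha)$ is. *)

theory Defs
  imports "HOL-Library.Poly_Mapping" "HOL-Combinatorics.Transposition"
begin

text \<open>
  The positive integers are modelled by the natural numbers \<open>i \<ge> 1\<close>.  The index \<open>0\<close> is unused: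
  permutations fix it, weak compositions vanish there, and the variable with index \<open>0\<close> never
  enters any of the key or atom polynomials.
\<close>


subsection \<open>The group of finitary permutations\<close>

definition sref :: "nat \<Rightarrow> nat \<Rightarrow> nat" where
  "sref i = transpose i (Suc i)"

definition word_perm :: "nat list \<Rightarrow> nat \<Rightarrow> nat" where
  "word_perm a = foldr (\<lambda>i v. sref i \<circ> v) a id"

text \<open>The generators are involutions, so words without inverses already give the group they generate.\<close>

definition S_inf :: "(nat \<Rightarrow> nat) set" where
  "S_inf = {word_perm a | a. set a \<subseteq> {1..}}"

definition perm_length :: "(nat \<Rightarrow> nat) \<Rightarrow> nat" where
  "perm_length w = (LEAST l. \<exists>a. set a \<subseteq> {1..} \<and> word_perm a = w \<and> length a = l)"

definition reduced_word :: "nat list \<Rightarrow> (nat \<Rightarrow> nat) \<Rightarrow> bool" where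
  "reduced_word a w \<longleftrightarrow> set a \<subseteq> {1..} \<and> word_perm a = w \<and> length a = perm_length w"


subsection \<open>Polynomials and isobaric divided differences\<close>

text \<open>Integer polynomials: finitely supported maps from exponent vectors to coefficients.\<close>

type_synonym zpoly = "(nat \<Rightarrow>\<^sub>0 nat) \<Rightarrow>\<^sub>0 int"

definition X :: "nat \<Rightarrow> zpoly" where
  "X i = Poly_Mapping.single (Poly_Mapping.single i 1) 1"

text \<open>
  The coefficient of the exponent vector \<open>m\<close> in \<open>perm_poly w f\<close> is that of \<open>m \<circ> w\<close> in \<open>f\<close>; for
  bijective \<open>w\<close> this is the substitution of \<open>X (w i)\<close> for \<open>X i\<close>.
\<close>

definition perm_poly :: "(nat \<Rightarrow> nat) \<Rightarrow> zpoly \<Rightarrow> zpoly" where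
  "perm_poly w f = Poly_Mapping.map_key (Poly_Mapping.map_key w) f"

text \<open>The quotient exists, and it is unique since polynomials form an integral domain.\<close>

definition pi_op :: "nat \<Rightarrow> zpoly \<Rightarrow> zpoly" where
  "pi_op i f =
    (THE g. (X i - X (Suc i)) * g = X i * f - X (Suc i) * perm_poly (sref i) f)"

definition pibar_op :: "nat \<Rightarrow> zpoly \<Rightarrow> zpoly" where
  "pibar_op i f = pi_op i f - f"

text \<open>By the braid relations the choice of the reduced word is immaterial.\<close>

definition pi_perm :: "(nat \<Rightarrow> nat) \<Rightarrow> zpoly \<Rightarrow> zpoly" where
  "pi_perm w f = foldr pi_op (SOME a. reduced_word a w) f"

definition pibar_perm :: "(nat \<Rightarrow> nat) \<Rightarrow> zpoly \<Rightarrow> zpoly" where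
  "pibar_perm w f = foldr pibar_op (SOME a. reduced_word a w) f"


subsection \<open>Weak compositions and partitions\<close>

definition weak_composition :: "(nat \<Rightarrow> nat) \<Rightarrow> bool" where
  "weak_composition \<alpha> \<longleftrightarrow> \<alpha> 0 = 0 \<and> finite {i. \<alpha> i \<noteq> 0}"

definition is_partition :: "(nat \<Rightarrow> nat) \<Rightarrow> bool" where
  "is_partition \<mu> \<longleftrightarrow> weak_composition \<mu> \<and> (\<forall>i\<ge>1. \<mu> (Suc i) \<le> \<mu> i)"

definition strict_partition :: "(nat \<Rightarrow> nat) \<Rightarrow> bool" where
  "strict_partition \<mu> \<longleftrightarrow> is_partition \<mu> \<and> inj_on \<mu> {i. \<mu> i \<noteq> 0}"

definition perm_act :: "(nat \<Rightarrow> nat) \<Rightarrow> (nat \<Rightarrow> nat) \<Rightarrow> nat \<Rightarrow> nat" where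
  "perm_act w \<alpha> = (\<lambda>i. \<alpha> (inv w i))"

definition sort_part :: "(nat \<Rightarrow> nat) \<Rightarrow> nat \<Rightarrow> nat" where
  "sort_part \<alpha> = (THE l. is_partition l \<and> (\<exists>w\<in>S_inf. \<alpha> = perm_act w l))"

definition min_perm :: "(nat \<Rightarrow> nat) \<Rightarrow> nat \<Rightarrow> nat" where
  "min_perm \<alpha> = (ARG_MIN perm_length u. u \<in> S_inf \<and> \<alpha> = perm_act u (sort_part \<alpha>))"

definition diagram :: "(nat \<Rightarrow> nat) \<Rightarrow> (nat \<times> nat) set" where
  "diagram \<mu> = {(i, j). 1 \<le> i \<and> 1 \<le> j \<and> j \<le> \<mu> i}"

definition conj_part :: "(nat \<Rightarrow> nat) \<Rightarrow> nat \<Rightarrow> nat" where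
  "conj_part l = (\<lambda>j. if j = 0 then 0 else card {i. 1 \<le> i \<and> j \<le> l i})"

definition symmetric_partition :: "(nat \<Rightarrow> nat) \<Rightarrow> bool" where
  "symmetric_partition l \<longleftrightarrow> is_partition l \<and> l = conj_part l"

definition symmetric_composition :: "(nat \<Rightarrow> nat) \<Rightarrow> bool" where
  "symmetric_composition \<alpha> \<longleftrightarrow> weak_composition \<alpha> \<and> symmetric_partition (sort_part \<alpha>)"

definition addable_corner :: "(nat \<Rightarrow> nat) \<Rightarrow> nat \<times> nat \<Rightarrow> bool" where
  "addable_corner l c \<longleftrightarrow>
    c \<notin> diagram l \<and> (\<exists>\<nu>. is_partition \<nu> \<and> diagram \<nu> = insert c (diagram l))"

definition removable_corner :: "(nat \<Rightarrow> nat) \<Rightarrow> nat \<times> nat \<Rightarrow> bool" where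
  "removable_corner l c \<longleftrightarrow>
    c \<in> diagram l \<and> (\<exists>\<nu>. is_partition \<nu> \<and> diagram \<nu> = diagram l - {c})"

definition skew_symmetric_partition :: "(nat \<Rightarrow> nat) \<Rightarrow> bool" where
  "skew_symmetric_partition l \<longleftrightarrow> is_partition l \<and> l = conj_part l \<and>
    (\<forall>i\<ge>1. (removable_corner l (i, i) \<longrightarrow> \<not> addable_corner l (i, i + 1)) \<and>
           (addable_corner l (i, i) \<longrightarrow> \<not> removable_corner l (i, i - 1)))"

definition skew_symmetric_composition :: "(nat \<Rightarrow> nat) \<Rightarrow> bool" where
  "skew_symmetric_composition \<alpha> \<longleftrightarrow>
    weak_composition \<alpha> \<and> skew_symmetric_partition (sort_part \<alpha>)"

text \<open>
  Truncated subtraction is harmless in the next two definitions: a nonpositive difference becomes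
  \<open>0\<close>, which the intersection with the positive integers discards.
\<close>

definition half_less :: "(nat \<Rightarrow> nat) \<Rightarrow> nat \<Rightarrow> nat" where
  "half_less l = (THE \<mu>. strict_partition \<mu> \<and>
    {\<mu> i | i. \<mu> i \<noteq> 0} = {l i - i | i. 1 \<le> i} \<inter> {1..})"

definition half_le :: "(nat \<Rightarrow> nat) \<Rightarrow> nat \<Rightarrow> nat" where
  "half_le l = (THE \<mu>. strict_partition \<mu> \<and>
    {\<mu> i | i. \<mu> i \<noteq> 0} = {l i - (i - 1) | i. 1 \<le> i} \<inter> {1..})"


subsection \<open>Key and atom polynomials\<close>

definition p_poly :: "(nat \<Rightarrow> nat) \<Rightarrow> zpoly" where
  "p_poly \<mu> = (\<Prod>(i, j)\<in>diagram \<mu>. X i + X (i + j))"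

definition q_poly :: "(nat \<Rightarrow> nat) \<Rightarrow> zpoly" where
  "q_poly \<mu> = (\<Prod>(i, j)\<in>diagram \<mu>. X i + X (i + j - 1))"

definition P_key :: "(nat \<Rightarrow> nat) \<Rightarrow> (nat \<Rightarrow> nat) \<Rightarrow> zpoly" where
  "P_key w \<mu> = pi_perm w (p_poly \<mu>)"

definition P_atom :: "(nat \<Rightarrow> nat) \<Rightarrow> (nat \<Rightarrow> nat) \<Rightarrow> zpoly" where
  "P_atom w \<mu> = pibar_perm w (p_poly \<mu>)"

definition Q_key :: "(nat \<Rightarrow> nat) \<Rightarrow> (nat \<Rightarrow> nat) \<Rightarrow> zpoly" where
  "Q_key w \<mu> = pi_perm w (q_poly \<mu>)"

definition Q_atom :: "(nat \<Rightarrow> nat) \<Rightarrow> (nat \<Rightarrow> nat) \<Rightarrow> zpoly" where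
  "Q_atom w \<mu> = pibar_perm w (q_poly \<mu>)"

definition P_key_comp :: "(nat \<Rightarrow> nat) \<Rightarrow> zpoly" where
  "P_key_comp \<alpha> = P_key (min_perm \<alpha>) (half_less (sort_part \<alpha>))"

definition P_atom_comp :: "(nat \<Rightarrow> nat) \<Rightarrow> zpoly" where
  "P_atom_comp \<alpha> = P_atom (min_perm \<alpha>) (half_less (sort_part \<alpha>))"

definition Q_key_comp :: "(nat \<Rightarrow> nat) \<Rightarrow> zpoly" where
  "Q_key_comp \<alpha> = Q_key (min_perm \<alpha>) (half_le (sort_part \<alpha>))"

definition Q_atom_comp :: "(nat \<Rightarrow> nat) \<Rightarrow> zpoly" where
  "Q_atom_comp \<alpha> = Q_atom (min_perm \<alpha>) (half_le (sort_part \<alpha>))"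

end

theory Submission
  imports Defs
begin

text \<open>
  The idea is to realise a strict partition \<open>\<mu>\<close> as one half of a symmetric Young diagram \<open>l\<close> and to
  take \<open>\<alpha> = perm_act w l\<close>.

  The polynomial \<open>q_poly \<mu>\<close> is a product of factors \<open>X i + X j\<close>.  Shifting row \<open>i\<close> of \<open>\<mu>\<close> to the right by
  \<open>i - 1\<close> makes the factor of a cell depend on its row and column only, and reflecting the shifted
  diagram in the main diagonal gives a symmetric partition \<open>l\<close> with \<open>half_le l = \<mu>\<close>
  (\<open>ex_symmetric_half_le\<close>).  So \<open>q_poly \<mu>\<close> is the product of \<open>X i + X j\<close> over the cells of \<open>l\<close> weakly above the
  diagonal.  If rows \<open>t\<close> and \<open>t + 1\<close> of \<open>l\<close> have the same length, then so have the two columns, hence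
  exchanging the indices \<open>t\<close> and \<open>t + 1\<close> permutes the cells up to reflection, and the symmetric factors
  \<open>X i + X j\<close> do not see the reflection: \<open>q_poly \<mu>\<close> is invariant under \<open>sref t\<close> (\<open>q_poly_invariant\<close>).
  For \<open>p_poly \<mu>\<close> the shift is by \<open>i\<close>, so that \<open>\<mu>\<close> prescribes the cells strictly above the diagonal.
  One diagonal cell is left to choose, and exactly one choice makes \<open>l\<close> skew-symmetric
  (\<open>ex_skew_symmetric_half_less\<close>).

  It remains to compare \<open>w\<close> with \<open>u = min_perm (perm_act w l)\<close>.  If \<open>w\<close> has a descent at a position \<open>i\<close>
  with \<open>l i = l (Suc i)\<close>, then \<open>pi_perm w f = pi_perm (w \<circ> sref i) (pi_op i f)\<close>, and \<open>pi_op i\<close> fixes every \<open>f\<close>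
  invariant under \<open>sref i\<close> while \<open>pibar_op i\<close> kills it.  Therefore such descents can be removed one after
  the other from a key polynomial (\<open>pi_perm_min_perm\<close>), whereas a single one makes the atom vanish
  (\<open>pibar_perm_min_perm\<close>).  When none is left, \<open>w\<close> is increasing on every block of equal parts of \<open>l\<close>;
  only one permutation with a given image of \<open>l\<close> has this property, and \<open>u\<close> has it because its length is
  minimal (\<open>min_perm_perm_act\<close>).

  Removing a descent requires that \<open>pi_perm w\<close> may be computed along any reduced word of \<open>w\<close>.  This is
  Matsumoto's theorem (\<open>reduced_words_agree\<close>), which rests on the braid relations of the operators and on the
  equality of length and number of inversions.
\<close>

section \<open>Permuting the variables of a polynomial\<close>

text \<open>
  Every finitely supported map is a sum of maps supported at one point; thus identities that are
  additive in a polynomial only have to be checked on monomials.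
\<close>

lemma poly_mapping_add_induct [case_names single add]:
  fixes f :: "('a \<Rightarrow>\<^sub>0 'b::comm_monoid_add)"
  assumes single: "\<And>m c. P (Poly_Mapping.single m c)"
    and add: "\<And>f g. P f \<Longrightarrow> P g \<Longrightarrow> P (f + g)"
  shows "P f"
proof (induction f rule: Poly_Mapping.update_induct)
  case const
  show ?case using single[of undefined 0] by simp
next
  case (update f a b)
  have "Poly_Mapping.update a b f = f + Poly_Mapping.single a b"
    using update(1)
    by (intro poly_mapping_eqI)
      (auto simp: lookup_update lookup_add lookup_single in_keys_iff when_def)
  then show ?case using update(3) single add by simp
qed

lemma map_key_inverse:
  assumes "bij w"
  shows "Poly_Mapping.map_key w (Poly_Mapping.map_key (inv w) m) = m"
    and "Poly_Mapping.map_key (inv w) (Poly_Mapping.map_key w n) = n"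
proof -
  have i: "inj w" "inj (inv w)" "inv w \<circ> w = (\<lambda>x. x)" "w \<circ> inv w = (\<lambda>x. x)"
    using assms by (auto simp: bij_is_inj bij_imp_bij_inv bij_is_surj surj_f_inv_f simp flip: id_def)
  show "Poly_Mapping.map_key w (Poly_Mapping.map_key (inv w) m) = m"
    by (simp only: map_key_compose[OF i(1) i(2)] i map_key_id)
  show "Poly_Mapping.map_key (inv w) (Poly_Mapping.map_key w n) = n"
    by (simp only: map_key_compose[OF i(2) i(1)] i map_key_id)
qed

lemma inj_map_key:
  assumes "bij w"
  shows "inj (Poly_Mapping.map_key w :: (_ \<Rightarrow>\<^sub>0 'b::zero) \<Rightarrow> _)"
  by (rule inj_on_inverseI[of _ "Poly_Mapping.map_key (inv w)"]) (rule map_key_inverse(2)[OF assms])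

text \<open>
  On monomials \<open>perm_poly w\<close> acts by relabelling the exponent vector, which is what
  makes it multiplicative.
\<close>

lemma perm_poly_single:
  assumes "bij w"
  shows "perm_poly w (Poly_Mapping.single m c) = Poly_Mapping.single (Poly_Mapping.map_key (inv w) m) c"
  unfolding perm_poly_def
  by (metis map_key_inverse(1)[OF assms] map_key_single[OF inj_map_key[OF assms]])

lemma perm_poly_add:
  assumes "bij w"
  shows "perm_poly w (f + g) = perm_poly w f + perm_poly w g"
  unfolding perm_poly_def by (rule map_key_plus[OF inj_map_key[OF assms]])

lemma perm_poly_diff:
  assumes "bij w"
  shows "perm_poly w (f - g) = perm_poly w f - perm_poly w g"
  by (metis perm_poly_add[OF assms] add_diff_cancel_right' diff_add_cancel)

lemma perm_poly_mult:
  assumes "bij w"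
  shows "perm_poly w (f * g) = perm_poly w f * perm_poly w g"
proof (induction f rule: poly_mapping_add_induct)
  case (single m c)
  show ?case
  proof (induction g rule: poly_mapping_add_induct)
    case (single n d)
    have "inj (inv w)" using assms by (simp add: bij_imp_bij_inv bij_is_inj)
    then show ?case by (simp add: perm_poly_single[OF assms] mult_single map_key_plus)
  qed (simp add: perm_poly_add[OF assms] distrib_left)
qed (simp add: perm_poly_add[OF assms] distrib_right)

lemma perm_poly_X:
  assumes "bij w"
  shows "perm_poly w (X i) = X (w i)"
proof -
  have "inj (inv w)" using assms by (simp add: bij_imp_bij_inv bij_is_inj)
  from map_key_single[OF this, of "w i" "1::nat"]
  have "Poly_Mapping.map_key (inv w) (Poly_Mapping.single i (1::nat)) = Poly_Mapping.single (w i) 1"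
    using assms by (simp add: bij_is_inj)
  then show ?thesis by (simp add: X_def perm_poly_single[OF assms])
qed

lemma perm_poly_one:
  assumes "bij w"
  shows "perm_poly w 1 = 1"
proof -
  have "Poly_Mapping.map_key (inv w) 0 = (0 :: nat \<Rightarrow>\<^sub>0 nat)"
    using assms by (intro map_key_zero) (simp add: bij_imp_bij_inv bij_is_inj)
  then show ?thesis using perm_poly_single[OF assms, of 0 1] by simp
qed

lemma perm_poly_prod:
  assumes "bij w"
  shows "perm_poly w (\<Prod>x\<in>A. f x) = (\<Prod>x\<in>A. perm_poly w (f x))"
  by (induction A rule: infinite_finite_induct)
    (simp_all add: perm_poly_one[OF assms] perm_poly_mult[OF assms])

lemma perm_poly_compose:
  assumes "bij v" "bij w"
  shows "perm_poly v (perm_poly w f) = perm_poly (v \<circ> w) f"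
proof -
  have "Poly_Mapping.map_key w \<circ> Poly_Mapping.map_key v
      = (Poly_Mapping.map_key (v \<circ> w) :: (nat \<Rightarrow>\<^sub>0 nat) \<Rightarrow> _)"
    using assms by (auto simp: fun_eq_iff map_key_compose bij_is_inj)
  then show ?thesis
    unfolding perm_poly_def using assms by (simp add: map_key_compose inj_map_key)
qed

lemma perm_poly_id: "perm_poly id f = f"
proof -
  have "(Poly_Mapping.map_key (\<lambda>x. x) :: (nat \<Rightarrow>\<^sub>0 nat) \<Rightarrow> _) = (\<lambda>x. x)"
    by (rule ext) (rule map_key_id)
  then show ?thesis unfolding perm_poly_def id_def by (simp only: map_key_id)
qed

lemma bij_sref [simp]: "bij (sref i)"
  by (simp add: sref_def)

lemma sref_sref [simp]: "sref i (sref i k) = k"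
  by (simp add: sref_def)

lemma sref_comp_sref [simp]: "sref i \<circ> sref i = id"
  by (simp add: sref_def)

lemma sref_first [simp]: "sref i i = Suc i"
  by (simp add: sref_def)

lemma sref_second [simp]: "sref i (Suc i) = i"
  by (simp add: sref_def)

lemma sref_other [simp]: "k \<noteq> i \<Longrightarrow> k \<noteq> Suc i \<Longrightarrow> sref i k = k"
  by (simp add: sref_def)

lemma sref_braid: "sref i \<circ> sref (Suc i) \<circ> sref i = sref (Suc i) \<circ> sref i \<circ> sref (Suc i)"
  by (auto simp: sref_def fun_eq_iff transpose_def)

lemma sref_commute: "Suc i < j \<Longrightarrow> sref i \<circ> sref j = sref j \<circ> sref i"
  by (auto simp: sref_def fun_eq_iff transpose_def)

lemmas sref_poly_simps [simp] =
  perm_poly_add[OF bij_sref] perm_poly_diff[OF bij_sref] perm_poly_mult[OF bij_sref]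
  perm_poly_X[OF bij_sref]

lemma sref_poly_involution [simp]: "perm_poly (sref i) (perm_poly (sref i) f) = f"
  by (simp add: perm_poly_compose perm_poly_id)

lemma sref_poly_braid:
  "perm_poly (sref i) (perm_poly (sref (Suc i)) (perm_poly (sref i) f))
   = perm_poly (sref (Suc i)) (perm_poly (sref i) (perm_poly (sref (Suc i)) f))"
  using sref_braid[of i] by (simp add: perm_poly_compose bij_comp comp_assoc)

lemma sref_poly_commute:
  "Suc i < j \<Longrightarrow> perm_poly (sref i) (perm_poly (sref j) f) = perm_poly (sref j) (perm_poly (sref i) f)"
  using sref_commute[of i j] by (simp add: perm_poly_compose)

lemma X_eq_iff [simp]: "X i = X j \<longleftrightarrow> i = j"
proof
  assume "X i = X j"
  then have "Poly_Mapping.keys (X i) = Poly_Mapping.keys (X j)" by simp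
  then have "Poly_Mapping.single i (1::nat) = Poly_Mapping.single j 1" by (simp add: X_def)
  then have "Poly_Mapping.keys (Poly_Mapping.single i (1::nat)) = Poly_Mapping.keys (Poly_Mapping.single j (1::nat))"
    by simp
  then show "i = j" by simp
qed simp

text \<open>
  A monomial is a constant multiplied by finitely many variables.
\<close>

lemma monomial_induct [case_names const X_mult]:
  assumes const: "\<And>c. P (Poly_Mapping.single 0 c)"
    and X_mult: "\<And>i f. P f \<Longrightarrow> P (X i * f)"
  shows "P (Poly_Mapping.single m c :: zpoly)"
proof (induction m rule: Poly_Mapping.update_induct)
  case const
  then show ?case by (rule assms)
next
  case (update m a b)
  have eq: "Poly_Mapping.update a b m = Poly_Mapping.single a b + m"
    using update(1)
    by (intro poly_mapping_eqI)
      (auto simp: lookup_update lookup_add lookup_single in_keys_iff when_def)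
  have "P (Poly_Mapping.single (Poly_Mapping.single a b + m) c)" for b
  proof (induction b)
    case 0
    show ?case using update(3) by simp
  next
    case (Suc b)
    have "Poly_Mapping.single (Poly_Mapping.single a (Suc b) + m) c
        = X a * Poly_Mapping.single (Poly_Mapping.single a b + m) c"
      by (simp add: X_def mult_single single_add[symmetric] add.assoc[symmetric])
    then show ?case using Suc X_mult by simp
  qed
  then show ?case by (simp add: eq)
qed

text \<open>
  This gives the existence of the quotient defining \<open>pi_op\<close>. The polynomials with
  this property contain constants and variables and are closed under sums and products, because
  \<open>x * f - sx * sf = (x - sx) * f + sx * (f - sf)\<close>.
\<close>

lemma dvd_diff_sref_poly: "X i - X (Suc i) dvd f - perm_poly (sref i) f"
proof (induction f rule: poly_mapping_add_induct)
  case (single m c)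
  show ?case
  proof (induction rule: monomial_induct)
    case (const c)
    have "Poly_Mapping.map_key (inv (sref i)) 0 = (0 :: nat \<Rightarrow>\<^sub>0 nat)"
      by (intro map_key_zero) (simp add: bij_imp_bij_inv bij_is_inj)
    then show ?case by (simp add: perm_poly_single)
  next
    case (X_mult k f)
    have "X i - X (Suc i) dvd X k - X (sref i k)"
    proof -
      consider "k = i" | "k = Suc i" | "k \<noteq> i" "k \<noteq> Suc i" by blast
      then show ?thesis
      proof cases
        case 2
        then show ?thesis using dvd_minus_iff[of "X i - X (Suc i)" "X i - X (Suc i)"] by simp
      qed auto
    qed
    moreover have "X k * f - X (sref i k) * perm_poly (sref i) f
        = (X k - X (sref i k)) * f + X (sref i k) * (f - perm_poly (sref i) f)"
      by (simp add: algebra_simps)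
    ultimately show ?case using X_mult by (auto intro!: dvd_add dvd_mult2 dvd_mult)
  qed
next
  case (add f g)
  have "f + g - perm_poly (sref i) (f + g) = (f - perm_poly (sref i) f) + (g - perm_poly (sref i) g)"
    by simp
  then show ?case using add by (metis dvd_add)
qed

section \<open>Isobaric divided differences and their braid relations\<close>

lemma pi_op_eqI:
  assumes "(X i - X (Suc i)) * g = X i * f - X (Suc i) * perm_poly (sref i) f"
  shows "pi_op i f = g"
  unfolding pi_op_def
proof (rule the_equality)
  fix h assume "(X i - X (Suc i)) * h = X i * f - X (Suc i) * perm_poly (sref i) f"
  then have "(X i - X (Suc i)) * h = (X i - X (Suc i)) * g" using assms by simp
  then show "h = g" by simp
qed (fact assms)

text \<open>
  The numerator is \<open>(X i - X (Suc i)) * f + X (Suc i) * (f - sf)\<close>, where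
  \<open>sf\<close> is \<open>f\<close> with the two variables exchanged.
\<close>

lemma pi_op:
  "(X i - X (Suc i)) * pi_op i f = X i * f - X (Suc i) * perm_poly (sref i) f"
proof -
  obtain h where h: "f - perm_poly (sref i) f = (X i - X (Suc i)) * h"
    using dvd_diff_sref_poly[of i f] by (auto elim: dvdE)
  have "X i * f - X (Suc i) * perm_poly (sref i) f
      = (X i - X (Suc i)) * f + X (Suc i) * (f - perm_poly (sref i) f)"
    by (simp add: algebra_simps)
  also have "\<dots> = (X i - X (Suc i)) * (f + X (Suc i) * h)"
    unfolding h by (simp add: algebra_simps)
  finally have e: "(X i - X (Suc i)) * (f + X (Suc i) * h)
      = X i * f - X (Suc i) * perm_poly (sref i) f" by simp
  show ?thesis using pi_op_eqI[OF e] e by simp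
qed

lemma pi_op_diff: "pi_op i (f - g) = pi_op i f - pi_op i g"
  by (rule pi_op_eqI) (simp add: right_diff_distrib pi_op)

lemma pi_op_invariant: "perm_poly (sref i) f = f \<Longrightarrow> pi_op i f = f"
  by (rule pi_op_eqI) (simp add: left_diff_distrib)

lemma sref_poly_pi_op [simp]: "perm_poly (sref i) (pi_op i f) = pi_op i f"
proof -
  have "perm_poly (sref i) ((X i - X (Suc i)) * pi_op i f)
      = perm_poly (sref i) (X i * f - X (Suc i) * perm_poly (sref i) f)"
    by (simp only: pi_op)
  then have "(X (Suc i) - X i) * perm_poly (sref i) (pi_op i f)
      = X (Suc i) * perm_poly (sref i) f - X i * f" by simp
  then have "- ((X (Suc i) - X i) * perm_poly (sref i) (pi_op i f))
      = - (X (Suc i) * perm_poly (sref i) f - X i * f)" by (rule arg_cong)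
  then have "(X i - X (Suc i)) * perm_poly (sref i) (pi_op i f)
      = X i * f - X (Suc i) * perm_poly (sref i) f"
    by (simp only: minus_mult_left minus_diff_eq)
  then show ?thesis using pi_op_eqI by metis
qed

lemma pi_op_idem [simp]: "pi_op i (pi_op i f) = pi_op i f"
  by (simp add: pi_op_invariant)

lemma sref_poly_pi_op_far:
  assumes "Suc i < j \<or> Suc j < i"
  shows "perm_poly (sref i) (pi_op j f) = pi_op j (perm_poly (sref i) f)"
proof (rule pi_op_eqI[symmetric])
  have far: "j \<noteq> i" "j \<noteq> Suc i" "Suc j \<noteq> i" "Suc j \<noteq> Suc i" using assms by auto
  have "perm_poly (sref i) ((X j - X (Suc j)) * pi_op j f)
      = perm_poly (sref i) (X j * f - X (Suc j) * perm_poly (sref j) f)"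
    by (simp only: pi_op)
  moreover have "perm_poly (sref i) (perm_poly (sref j) f) = perm_poly (sref j) (perm_poly (sref i) f)"
    using assms sref_poly_commute[of i j f] sref_poly_commute[of j i f] by auto
  ultimately show "(X j - X (Suc j)) * perm_poly (sref i) (pi_op j f)
      = X j * perm_poly (sref i) f - X (Suc j) * perm_poly (sref j) (perm_poly (sref i) f)"
    using far by simp
qed

lemma pi_op_commute:
  assumes "Suc i < j"
  shows "pi_op i (pi_op j f) = pi_op j (pi_op i f)"
proof (rule pi_op_eqI)
  let ?Dj = "X j - X (Suc j)"
  have far: "j \<noteq> i" "j \<noteq> Suc i" "Suc j \<noteq> i" "Suc j \<noteq> Suc i" using assms by auto
  have "?Dj * ((X i - X (Suc i)) * pi_op j (pi_op i f))
      = (X i - X (Suc i)) * (?Dj * pi_op j (pi_op i f))" by (rule mult.left_commute)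
  also have "\<dots> = X j * ((X i - X (Suc i)) * pi_op i f)
      - X (Suc j) * ((X i - X (Suc i)) * pi_op i (perm_poly (sref j) f))"
    unfolding pi_op[of j] using assms by (simp add: sref_poly_pi_op_far algebra_simps)
  also have "\<dots> = X i * (?Dj * pi_op j f) - X (Suc i) * (?Dj * pi_op j (perm_poly (sref i) f))"
    unfolding pi_op by (simp add: sref_poly_commute[OF assms] algebra_simps)
  also have "\<dots> = ?Dj * (X i * pi_op j f - X (Suc i) * perm_poly (sref i) (pi_op j f))"
    using assms by (simp add: sref_poly_pi_op_far algebra_simps)
  finally show "(X i - X (Suc i)) * pi_op j (pi_op i f)
      = X i * pi_op j f - X (Suc i) * perm_poly (sref i) (pi_op j f)" by simp
qed

lemma sref_poly_pi_op_eq: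
  "(X (sref j i) - X (sref j (Suc i))) * perm_poly (sref j) (pi_op i f)
   = X (sref j i) * perm_poly (sref j) f - X (sref j (Suc i)) * perm_poly (sref j) (perm_poly (sref i) f)"
  using arg_cong[OF pi_op[of i f], of "perm_poly (sref j)"] by simp

text \<open>
  Multiplying either side by the Vandermonde product \<open>V\<close> of the three variables and
  clearing the denominators from outside to inside gives the same signed sum \<open>W\<close> over
  the six permutations of these variables; and polynomials have no zero divisors.
\<close>

lemma pi_op_braid:
  "pi_op i (pi_op (Suc i) (pi_op i f)) = pi_op (Suc i) (pi_op i (pi_op (Suc i) f))"
proof -
  define x y z where "x = X i" and "y = X (Suc i)" and "z = X (Suc (Suc i))"
  let ?s = "perm_poly (sref i)" and ?t = "perm_poly (sref (Suc i))"
  define V where "V = (x - y) * (y - z) * (x - z)"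
  define W where "W = x*x*y*f - x*y*y * ?s f - x*x*z * ?t f + x*z*z * ?t (?s f)
      + y*y*z * ?s (?t f) - y*z*z * ?s (?t (?s f))"
  have 1: "(x - y) * pi_op i h = x * h - y * ?s h" for h
    unfolding x_def y_def by (rule pi_op)
  have 2: "(y - z) * pi_op (Suc i) h = y * h - z * ?t h" for h
    unfolding y_def z_def by (rule pi_op)
  have 3: "(x - z) * ?t (pi_op i h) = x * ?t h - z * ?t (?s h)" for h
    using sref_poly_pi_op_eq[of "Suc i" i h] by (simp add: x_def z_def)
  have 4: "(x - z) * ?s (pi_op (Suc i) h) = x * ?s h - z * ?s (?t h)" for h
    using sref_poly_pi_op_eq[of i "Suc i" h] by (simp add: x_def z_def)
  have 5: "(y - z) * ?s (?t (pi_op i h)) = y * ?s (?t h) - z * ?s (?t (?s h))" for h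
    using arg_cong[OF 3[of h], of ?s] by (simp add: x_def y_def z_def)
  have 6: "(x - y) * ?t (?s (pi_op (Suc i) h)) = x * ?t (?s h) - y * ?t (?s (?t h))" for h
    using arg_cong[OF 4[of h], of ?t] by (simp add: x_def y_def z_def)
  have "V * pi_op i (pi_op (Suc i) (pi_op i f))
      = (y - z) * (x - z) * (x * pi_op (Suc i) (pi_op i f) - y * ?s (pi_op (Suc i) (pi_op i f)))"
    unfolding V_def 1[symmetric] by (simp only: mult_ac)
  also have "\<dots> = x * (x - z) * ((y - z) * pi_op (Suc i) (pi_op i f))
      - y * (y - z) * ((x - z) * ?s (pi_op (Suc i) (pi_op i f)))"
    by (simp add: algebra_simps)
  also have "\<dots> = x * (x - z) * (y * pi_op i f - z * ?t (pi_op i f))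
      - y * (y - z) * (x * pi_op i f - z * ?s (?t (pi_op i f)))"
    unfolding 2 4 by simp
  also have "\<dots> = x * y * ((x - y) * pi_op i f) - x * z * ((x - z) * ?t (pi_op i f))
      + y * z * ((y - z) * ?s (?t (pi_op i f)))"
    by (simp add: algebra_simps)
  also have "\<dots> = W" unfolding 1 3 5 W_def by (simp add: algebra_simps)
  finally have L: "V * pi_op i (pi_op (Suc i) (pi_op i f)) = W" .
  let ?A = "pi_op (Suc i) f"
  have "V * pi_op (Suc i) (pi_op i ?A)
      = (x - y) * (x - z) * (y * pi_op i ?A - z * ?t (pi_op i ?A))"
    unfolding V_def 2[symmetric] by (simp only: mult_ac)
  also have "\<dots> = y * (x - z) * ((x - y) * pi_op i ?A) - z * (x - y) * ((x - z) * ?t (pi_op i ?A))"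
    by (simp add: algebra_simps)
  also have "\<dots> = y * (x - z) * (x * ?A - y * ?s ?A) - z * (x - y) * (x * ?A - z * ?t (?s ?A))"
    unfolding 1 3 by simp
  also have "\<dots> = x * x * ((y - z) * ?A) - y * y * ((x - z) * ?s ?A) + z * z * ((x - y) * ?t (?s ?A))"
    by (simp add: algebra_simps)
  also have "\<dots> = W" unfolding 2 4 6 W_def sref_poly_braid by (simp add: algebra_simps)
  finally have R: "V * pi_op (Suc i) (pi_op i ?A) = W" .
  have "V \<noteq> 0" by (simp add: V_def x_def y_def z_def)
  then show ?thesis using L R by (metis mult_left_cancel)
qed

lemma pibar_op_commute:
  "Suc i < j \<Longrightarrow> pibar_op i (pibar_op j f) = pibar_op j (pibar_op i f)"
  by (simp add: pibar_op_def pi_op_diff pi_op_commute[of i j])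

text \<open>
  Expanding \<open>pibar_op i = pi_op i - 1\<close> and using idempotence, both sides become the
  same expression up to the braid relation of \<open>pi_op\<close>.
\<close>

lemma pibar_op_braid:
  "pibar_op i (pibar_op (Suc i) (pibar_op i f)) = pibar_op (Suc i) (pibar_op i (pibar_op (Suc i) f))"
  by (simp add: pibar_op_def pi_op_diff pi_op_braid)

section \<open>Length and inversions\<close>

lemma word_perm_Nil [simp]: "word_perm [] = id"
  by (simp add: word_perm_def)

lemma word_perm_Cons [simp]: "word_perm (i # a) = sref i \<circ> word_perm a"
  by (simp add: word_perm_def)

lemma word_perm_append [simp]: "word_perm (a @ b) = word_perm a \<circ> word_perm b"
  by (induction a) (simp_all add: comp_assoc)

lemma S_inf_bij: "w \<in> S_inf \<Longrightarrow> bij w"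
proof -
  have "bij (word_perm a)" for a
  proof (induction a)
    case Nil
    show ?case unfolding word_perm_Nil by (rule bij_id)
  next
    case (Cons i a)
    show ?case unfolding word_perm_Cons by (rule bij_comp[OF Cons.IH bij_sref])
  qed
  then show "w \<in> S_inf \<Longrightarrow> bij w" by (auto simp: S_inf_def)
qed

lemma S_inf_0: "w \<in> S_inf \<Longrightarrow> w 0 = 0"
proof -
  have "set a \<subseteq> {1..} \<Longrightarrow> word_perm a 0 = 0" for a
    by (induction a) auto
  then show "w \<in> S_inf \<Longrightarrow> w 0 = 0" by (auto simp: S_inf_def)
qed

lemma S_inf_finitary: "w \<in> S_inf \<Longrightarrow> \<exists>N. \<forall>k>N. w k = k"
proof -
  have "\<exists>N. \<forall>k>N. word_perm a k = k" for a
  proof (induction a)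
    case (Cons i a)
    then obtain N where "\<forall>k>N. word_perm a k = k" by blast
    then have "\<forall>k>max N (Suc i). word_perm (i # a) k = k" by simp
    then show ?case by blast
  qed simp
  then show "w \<in> S_inf \<Longrightarrow> \<exists>N. \<forall>k>N. w k = k" by (auto simp: S_inf_def)
qed

lemma S_inf_comp_sref:
  assumes "w \<in> S_inf" "1 \<le> i"
  shows "w \<circ> sref i \<in> S_inf"
proof -
  obtain a where "set a \<subseteq> {1..}" "w = word_perm a" using assms(1) by (auto simp: S_inf_def)
  then have "set (a @ [i]) \<subseteq> {1..}" "w \<circ> sref i = word_perm (a @ [i])" using assms(2) by auto
  then show ?thesis unfolding S_inf_def by blast
qed

definition inversions :: "(nat \<Rightarrow> nat) \<Rightarrow> (nat \<times> nat) set" where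
  "inversions w = {(a, b). a < b \<and> w b < w a}"

lemma finite_inversions:
  assumes "w \<in> S_inf"
  shows "finite (inversions w)"
proof -
  obtain N where N: "\<forall>k>N. w k = k" using S_inf_finitary[OF assms] by blast
  have inj: "w x = w y \<longleftrightarrow> x = y" for x y using S_inf_bij[OF assms] by (simp add: bij_is_inj inj_eq)
  have "inversions w \<subseteq> {..N} \<times> {..N}"
  proof
    fix p assume "p \<in> inversions w"
    then obtain a b where p: "p = (a, b)" "a < b" "w b < w a" by (auto simp: inversions_def)
    have "b \<le> N"
    proof (rule ccontr)
      assume "\<not> b \<le> N"
      then have "b < w a" using N p by simp
      then have "w (w a) = w a" using N \<open>\<not> b \<le> N\<close> by simp
      then have "w a = a" using inj by blast
      then show False using \<open>b < w a\<close> p by simp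
    qed
    then show "p \<in> {..N} \<times> {..N}" using p by simp
  qed
  then show ?thesis by (rule finite_subset) simp
qed

text \<open>
  Relabelling both positions of an inversion of \<open>w\<close> by \<open>sref i\<close> gives an
  inversion of \<open>w \<circ> sref i\<close>, since \<open>sref i\<close> preserves the order of
  every pair of positions other than \<open>(i, Suc i)\<close>; that pair is the one new
  inversion.
\<close>

lemma card_inversions_ascent:
  assumes "w \<in> S_inf" "w i < w (Suc i)"
  shows "card (inversions (w \<circ> sref i)) = Suc (card (inversions w))"
proof -
  let ?m = "map_prod (sref i) (sref i)"
  have lt: "sref i a < sref i b" if "a < b" "(a, b) \<noteq> (i, Suc i)" for a b
    using that by (auto simp: sref_def transpose_def)
  have "inversions (w \<circ> sref i) = insert (i, Suc i) (?m ` inversions w)" (is "?L = ?R")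
  proof
    show "?L \<subseteq> ?R"
    proof
      fix p assume "p \<in> ?L"
      then obtain a b where p: "p = (a, b)" "a < b" "w (sref i b) < w (sref i a)"
        by (auto simp: inversions_def)
      show "p \<in> ?R"
      proof (cases "(a, b) = (i, Suc i)")
        case False
        then have "(sref i a, sref i b) \<in> inversions w" using lt[of a b] p by (simp add: inversions_def)
        moreover have "?m (sref i a, sref i b) = (a, b)" by simp
        ultimately show ?thesis using p(1) by (metis image_eqI insertI2)
      qed (simp add: p)
    qed
    show "?R \<subseteq> ?L"
    proof
      fix p assume "p \<in> ?R"
      then consider "p = (i, Suc i)" | a b where "p = (sref i a, sref i b)" "a < b" "w b < w a"
        by (auto simp: inversions_def)
      then show "p \<in> ?L"
      proof cases
        case 2
        then have "(a, b) \<noteq> (i, Suc i)" using assms(2) by auto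
        then show ?thesis using 2 lt by (simp add: inversions_def)
      qed (use assms(2) in \<open>simp add: inversions_def\<close>)
    qed
  qed
  moreover have "(i, Suc i) \<notin> ?m ` inversions w"
  proof
    assume "(i, Suc i) \<in> ?m ` inversions w"
    then obtain a b where ab: "i = sref i a" "Suc i = sref i b" "a < b" by (auto simp: inversions_def)
    then have "a = Suc i" "b = i" by (metis sref_sref sref_first, metis sref_sref sref_second)
    then show False using ab(3) by simp
  qed
  moreover have "card (?m ` inversions w) = card (inversions w)"
    by (rule card_image) (auto simp: inj_on_def sref_def dest: transpose_eq_imp_eq)
  ultimately show ?thesis using finite_inversions[OF assms(1)] by simp
qed

lemma card_inversions_descent:
  assumes "w \<in> S_inf" "1 \<le> i" "w (Suc i) < w i"
  shows "card (inversions w) = Suc (card (inversions (w \<circ> sref i)))"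
  using card_inversions_ascent[OF S_inf_comp_sref[OF assms(1,2)], of i] assms(3)
  by (simp add: comp_assoc)

lemma card_inversions_le_word:
  assumes "set a \<subseteq> {1..}"
  shows "card (inversions (word_perm a)) \<le> length a"
  using assms
proof (induction a rule: rev_induct)
  case Nil
  have "inversions (word_perm []) = {}" by (auto simp: inversions_def)
  then show ?case by (simp only: card.empty)
next
  case (snoc i a)
  have w: "word_perm a \<in> S_inf" and i: "1 \<le> i" using snoc.prems by (auto simp: S_inf_def)
  have "word_perm a i \<noteq> word_perm a (Suc i)"
    using S_inf_bij[OF w] by (simp add: bij_is_inj inj_eq)
  then have "card (inversions (word_perm a \<circ> sref i)) \<le> Suc (card (inversions (word_perm a)))"
    using card_inversions_ascent[OF w, of i] card_inversions_descent[OF w i]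
    by (cases "word_perm a i < word_perm a (Suc i)") auto
  moreover have "word_perm (a @ [i]) = word_perm a \<circ> sref i"
    by (simp only: word_perm_append word_perm_Cons word_perm_Nil comp_id)
  moreover have "card (inversions (word_perm a)) \<le> length a" using snoc by simp
  ultimately show ?case by (simp only: length_append list.size)
qed

lemma strict_mono_bij_nat_id:
  fixes w :: "nat \<Rightarrow> nat"
  assumes "bij w" "strict_mono w"
  shows "w = id"
proof
  fix n
  have "strict_mono (inv w)"
    using strict_mono_inv[OF assms(2), of "inv w"] assms(1) by (simp add: bij_is_surj bij_is_inj)
  then have "n \<le> inv w n" by (rule strict_mono_imp_increasing)
  then have "w n \<le> w (inv w n)" using assms(2) by (simp add: strict_mono_less_eq)
  then have "w n \<le> n" using assms(1) by (simp add: bij_is_surj surj_f_inv_f)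
  then show "w n = id n" using strict_mono_imp_increasing[OF assms(2), of n] by simp
qed

text \<open>
  Sorting by adjacent transpositions: each step at a descent removes one inversion, and a
  permutation without descents is increasing, hence the identity.
\<close>

lemma ex_word_of_inversion_length:
  assumes "w \<in> S_inf"
  shows "\<exists>a. set a \<subseteq> {1..} \<and> word_perm a = w \<and> length a = card (inversions w)"
  using assms
proof (induction "card (inversions w)" arbitrary: w rule: less_induct)
  case less
  show ?case
  proof (cases "\<exists>i\<ge>1. w (Suc i) < w i")
    case True
    then obtain i where i: "1 \<le> i" "w (Suc i) < w i" by blast
    note d = card_inversions_descent[OF less.prems i]
    obtain a where "set a \<subseteq> {1..}" "word_perm a = w \<circ> sref i" "length a = card (inversions (w \<circ> sref i))"
      using less.hyps[OF _ S_inf_comp_sref[OF less.prems i(1)]] d by auto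
    then have "set (a @ [i]) \<subseteq> {1..} \<and> word_perm (a @ [i]) = w \<and> length (a @ [i]) = card (inversions w)"
      using i d by (simp add: comp_assoc)
    then show ?thesis by blast
  next
    case False
    have inj: "w x = w y \<longleftrightarrow> x = y" for x y
      using S_inf_bij[OF less.prems] by (simp add: bij_is_inj inj_eq)
    have "w n < w (Suc n)" for n
    proof (cases "n = 0")
      case True
      then show ?thesis using inj[of n "Suc n"] S_inf_0[OF less.prems] by simp
    next
      case n: False
      then show ?thesis using False inj[of n "Suc n"] by (metis One_nat_def Suc_leI n_not_Suc_n nat_neq_iff not_gr0)
    qed
    then have "w = id"
      using strict_mono_bij_nat_id[OF S_inf_bij[OF less.prems]] by (simp add: strict_mono_Suc_iff)
    moreover have "inversions id = {}" by (auto simp: inversions_def)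
    ultimately show ?thesis by (intro exI[of _ "[]"]) simp
  qed
qed

lemma perm_length_eq_inversions:
  assumes "w \<in> S_inf"
  shows "perm_length w = card (inversions w)"
  unfolding perm_length_def
proof (rule Least_equality)
  show "\<exists>a. set a \<subseteq> {1..} \<and> word_perm a = w \<and> length a = card (inversions w)"
    by (rule ex_word_of_inversion_length[OF assms])
next
  fix l assume "\<exists>a. set a \<subseteq> {1..} \<and> word_perm a = w \<and> length a = l"
  then show "card (inversions w) \<le> l" using card_inversions_le_word by blast
qed

lemma perm_length_ascent:
  assumes "w \<in> S_inf" "1 \<le> i" "w i < w (Suc i)"
  shows "perm_length (w \<circ> sref i) = Suc (perm_length w)"
  using card_inversions_ascent[OF assms(1,3)] perm_length_eq_inversions[OF assms(1)]
    perm_length_eq_inversions[OF S_inf_comp_sref[OF assms(1,2)]] by simp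

lemma perm_length_descent:
  assumes "w \<in> S_inf" "1 \<le> i" "w (Suc i) < w i"
  shows "perm_length w = Suc (perm_length (w \<circ> sref i))"
  using card_inversions_descent[OF assms] perm_length_eq_inversions[OF assms(1)]
    perm_length_eq_inversions[OF S_inf_comp_sref[OF assms(1,2)]] by simp

lemma ex_reduced_word:
  assumes "w \<in> S_inf"
  shows "\<exists>a. reduced_word a w"
  using ex_word_of_inversion_length[OF assms] perm_length_eq_inversions[OF assms]
  unfolding reduced_word_def by auto

lemma reduced_word_in_S_inf: "reduced_word a w \<Longrightarrow> w \<in> S_inf"
  unfolding reduced_word_def S_inf_def by blast

text \<open>
  The last letters of reduced words are the descents of \<open>w\<close>. All inductions over
  reduced words below proceed from the right.
\<close>

lemma reduced_word_snoc:
  "reduced_word (a @ [i]) w \<longleftrightarrow>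
    1 \<le> i \<and> w \<in> S_inf \<and> w (Suc i) < w i \<and> reduced_word a (w \<circ> sref i)"
proof
  assume r: "reduced_word (a @ [i]) w"
  then have w: "w \<in> S_inf" by (rule reduced_word_in_S_inf)
  have i: "1 \<le> i" and a: "set a \<subseteq> {1..}" and wa: "w = word_perm a \<circ> sref i"
    and l: "Suc (length a) = perm_length w"
    using r by (auto simp: reduced_word_def)
  have e: "word_perm a = w \<circ> sref i" using wa by (simp add: comp_assoc)
  \<comment> \<open>An ascent at \<open>i\<close> would make \<open>w \<circ> sref i\<close> longer than its word \<open>a\<close>.\<close>
  have le: "perm_length (w \<circ> sref i) \<le> length a"
    using card_inversions_le_word[OF a] perm_length_eq_inversions[OF S_inf_comp_sref[OF w i]] e by simp
  have "w i \<noteq> w (Suc i)" using S_inf_bij[OF w] by (simp add: bij_is_inj inj_eq)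
  then have d: "w (Suc i) < w i" using perm_length_ascent[OF w i] le l by fastforce
  then show "1 \<le> i \<and> w \<in> S_inf \<and> w (Suc i) < w i \<and> reduced_word a (w \<circ> sref i)"
    using i w a e l perm_length_descent[OF w i d] by (simp add: reduced_word_def)
next
  assume "1 \<le> i \<and> w \<in> S_inf \<and> w (Suc i) < w i \<and> reduced_word a (w \<circ> sref i)"
  then show "reduced_word (a @ [i]) w"
    using perm_length_descent[of w i] by (auto simp: reduced_word_def comp_assoc)
qed

section \<open>Independence of the reduced word\<close>

text \<open>
  What \<open>pi_op\<close> and \<open>pibar_op\<close> have in common: operators that satisfy the
  defining relations of the 0-Hecke monoid except idempotence.
\<close>

locale braid_operators =
  fixes T :: "nat \<Rightarrow> 'b \<Rightarrow> 'b"
  assumes commute: "Suc i < j \<Longrightarrow> T i (T j f) = T j (T i f)"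
    and braid: "T i (T (Suc i) (T i f)) = T (Suc i) (T i (T (Suc i) f))"
begin

text \<open>
  The case of Matsumoto's theorem where the words end in different letters \<open>i < j\<close>.
  Both are descents of \<open>w\<close>, so \<open>w\<close> factors, with lengths adding up,
  through the longest element of the subgroup generated by \<open>sref i\<close> and \<open>sref
  j\<close>. A reduced word \<open>c\<close> of the remaining factor extends to reduced words of
  \<open>w\<close> ending in \<open>i\<close> and in \<open>j\<close>, to which the two given
  words can be compared by induction; the two extensions differ by one commutation or braid
  relation.
\<close>

lemma foldr_two_descents:
  assumes IH: "\<And>v a b f. perm_length v < perm_length w \<Longrightarrow> reduced_word a v \<Longrightarrow> reduced_word b v
      \<Longrightarrow> foldr T a f = foldr T b f"
    and a: "reduced_word (a @ [i]) w" and b: "reduced_word (b @ [j]) w" and "i < j"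
  shows "foldr T (a @ [i]) f = foldr T (b @ [j]) f"
proof -
  from a b have i: "1 \<le> i" "w (Suc i) < w i" and ra: "reduced_word a (w \<circ> sref i)"
    and j: "1 \<le> j" "w (Suc j) < w j" and rb: "reduced_word b (w \<circ> sref j)" and w: "w \<in> S_inf"
    by (auto simp: reduced_word_snoc)
  have wi: "w \<circ> sref i \<in> S_inf" and wj: "w \<circ> sref j \<in> S_inf"
    using S_inf_comp_sref w i j by auto
  have li: "perm_length (w \<circ> sref i) < perm_length w" and lj: "perm_length (w \<circ> sref j) < perm_length w"
    using perm_length_descent[OF w i] perm_length_descent[OF w j] by auto
  show ?thesis
  proof (cases "j = Suc i")
    case False
    then have far: "Suc i < j" using \<open>i < j\<close> by simp
    define v where "v = w \<circ> sref i \<circ> sref j"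
    have v': "v = w \<circ> sref j \<circ> sref i"
      using sref_commute[OF far] by (simp add: v_def comp_assoc)
    have "v \<in> S_inf" unfolding v_def using S_inf_comp_sref wi j by auto
    then obtain c where c: "reduced_word c v" using ex_reduced_word by blast
    have "reduced_word (c @ [j]) (w \<circ> sref i)"
      using c wi j far by (simp add: reduced_word_snoc flip: v_def)
    then have A: "foldr T a (T i f) = foldr T c (T j (T i f))"
      using IH[OF li ra] by simp
    have "reduced_word (c @ [i]) (w \<circ> sref j)"
      using c wj i far by (simp add: reduced_word_snoc flip: v')
    then have B: "foldr T b (T j f) = foldr T c (T i (T j f))"
      using IH[OF lj rb] by simp
    show ?thesis using A B commute[OF far] by simp
  next
    case j_def: True
    define v where "v = w \<circ> sref i \<circ> sref j \<circ> sref i"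
    have v': "v = w \<circ> sref j \<circ> sref i \<circ> sref j"
      using sref_braid[of i] by (simp add: v_def j_def comp_assoc)
    have wij: "w \<circ> sref i \<circ> sref j \<in> S_inf" and wji: "w \<circ> sref j \<circ> sref i \<in> S_inf"
      using S_inf_comp_sref wi wj i j by auto
    have "v \<in> S_inf" unfolding v_def using S_inf_comp_sref wij i by auto
    then obtain c where c: "reduced_word c v" using ex_reduced_word by blast
    have "reduced_word (c @ [i]) (w \<circ> sref i \<circ> sref j)"
      using c wij i j by (simp add: reduced_word_snoc j_def flip: v_def[unfolded j_def])
    then have "reduced_word ((c @ [i]) @ [j]) (w \<circ> sref i)"
      unfolding reduced_word_snoc[of "c @ [i]"] using wi i j by (simp add: j_def)
    then have A: "foldr T a (T i f) = foldr T c (T i (T j (T i f)))"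
      using IH[OF li ra] by simp
    have "reduced_word (c @ [j]) (w \<circ> sref j \<circ> sref i)"
      using c wji i j by (simp add: reduced_word_snoc j_def flip: v'[unfolded j_def])
    then have "reduced_word ((c @ [j]) @ [i]) (w \<circ> sref j)"
      unfolding reduced_word_snoc[of "c @ [j]"] using wj i j by (simp add: j_def)
    then have B: "foldr T b (T j f) = foldr T c (T j (T i (T j f)))"
      using IH[OF lj rb] by simp
    show ?thesis using A B braid[of i f] by (simp add: j_def)
  qed
qed

lemma reduced_words_agree:
  "reduced_word a w \<Longrightarrow> reduced_word b w \<Longrightarrow> foldr T a f = foldr T b f"
proof (induction "perm_length w" arbitrary: w a b f rule: less_induct)
  case less
  note IH = less.hyps
  have td: "foldr T (a @ [i]) f = foldr T (b @ [j]) f"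
    if "reduced_word (a @ [i]) w" "reduced_word (b @ [j]) w" "i < j" for a b i j
    by (rule foldr_two_descents[OF IH that])
  have len: "length a = length b" using less.prems by (simp add: reduced_word_def)
  show ?case
  proof (cases a rule: rev_cases)
    case Nil
    then show ?thesis using len by simp
  next
    case a: (snoc a' i)
    then obtain b' j where b: "b = b' @ [j]" using len by (cases b rule: rev_cases) auto
    consider "i < j" | "j < i" | "i = j" by linarith
    then show ?thesis
    proof cases
      case 1
      then show ?thesis using td less.prems a b by blast
    next
      case 2
      then show ?thesis using td less.prems a b by metis
    next
      case 3
      have "perm_length (w \<circ> sref i) < perm_length w"
        using less.prems(1) perm_length_descent[of w i] unfolding a by (simp add: reduced_word_snoc)
      then show ?thesis
        using IH[of "w \<circ> sref i" a' b' "T i f"] less.prems 3 unfolding a b by (simp add: reduced_word_snoc)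
    qed
  qed
qed

definition act :: "(nat \<Rightarrow> nat) \<Rightarrow> 'b \<Rightarrow> 'b" where
  "act w f = foldr T (SOME a. reduced_word a w) f"

lemma act_descent:
  assumes "w \<in> S_inf" "1 \<le> i" "w (Suc i) < w i"
  shows "act w f = act (w \<circ> sref i) (T i f)"
proof -
  obtain a where a: "reduced_word a (w \<circ> sref i)"
    using ex_reduced_word S_inf_comp_sref assms by blast
  then have "reduced_word (a @ [i]) w" using assms by (simp add: reduced_word_snoc)
  then have "act w f = foldr T (a @ [i]) f"
    unfolding act_def by (metis reduced_words_agree someI)
  also have "\<dots> = act (w \<circ> sref i) (T i f)"
    unfolding act_def using a by (metis (no_types, lifting) foldr_append foldr.simps o_apply id_apply reduced_words_agree someI)
  finally show ?thesis .
qed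

end

section \<open>Partitions and their rearrangements\<close>

text \<open>
  Row and column lengths of diagrams are cardinalities; this turns them into membership
  conditions.
\<close>

lemma initial_segment_eq:
  fixes S :: "nat set"
  assumes "finite S" "0 \<notin> S" "\<And>i. 1 \<le> i \<Longrightarrow> Suc i \<in> S \<Longrightarrow> i \<in> S"
  shows "S = {1..card S}"
proof (cases "S = {}")
  case False
  define m where "m = Max S"
  have "m \<in> S" using assms(1) False by (simp add: m_def)
  have "i \<in> S" if "1 \<le> i" "i \<le> m" for i
    using that(2,1)
  proof (induction rule: inc_induct)
    case (step n)
    then show ?case using assms(3)[of n] by simp
  qed (simp add: \<open>m \<in> S\<close>)
  moreover have "i \<le> m" if "i \<in> S" for i
    using that assms(1) by (simp add: m_def)
  moreover have "1 \<le> i" if "i \<in> S" for i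
    using that assms(2) by (cases i) auto
  ultimately have "S = {1..m}" by (intro set_eqI) (metis atLeastAtMost_iff)
  then show ?thesis by simp
qed simp

lemma partition_antimono:
  assumes "is_partition l" "1 \<le> i" "i \<le> j"
  shows "l j \<le> l i"
  using assms(3)
proof (induction rule: dec_induct)
  case (step n)
  then have "l (Suc n) \<le> l n" using assms(1,2) by (simp add: is_partition_def)
  then show ?case using step.IH by simp
qed simp

lemma partition_0: "is_partition l \<Longrightarrow> l 0 = 0"
  by (simp add: is_partition_def weak_composition_def)

lemma partition_finite_rows:
  assumes "is_partition l" "1 \<le> j"
  shows "finite {i. 1 \<le> i \<and> j \<le> l i}"
proof (rule finite_subset)
  show "{i. 1 \<le> i \<and> j \<le> l i} \<subseteq> {i. l i \<noteq> 0}" using assms(2) by auto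
  show "finite {i. l i \<noteq> 0}" using assms(1) by (simp add: is_partition_def weak_composition_def)
qed

text \<open>
  Membership of the cell \<open>(i, j)\<close> in the diagram, read by columns and by rows.
\<close>

lemma conj_part_iff:
  assumes "is_partition l" "1 \<le> i" "1 \<le> j"
  shows "i \<le> conj_part l j \<longleftrightarrow> j \<le> l i"
proof -
  let ?S = "{i. 1 \<le> i \<and> j \<le> l i}"
  have "?S = {1..card ?S}"
  proof (rule initial_segment_eq)
    fix i assume "1 \<le> i" "Suc i \<in> ?S"
    then show "i \<in> ?S" using partition_antimono[OF assms(1), of i "Suc i"] by simp
  qed (use partition_finite_rows[OF assms(1,3)] in auto)
  then have "i \<in> ?S \<longleftrightarrow> i \<in> {1..card ?S}" by (rule arg_cong)
  then show ?thesis using assms by (auto simp: conj_part_def)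
qed

lemma partition_eqI:
  assumes "is_partition l" "is_partition m" "\<And>j. 1 \<le> j \<Longrightarrow> conj_part l j = conj_part m j"
  shows "l = m"
proof
  fix i
  show "l i = m i"
  proof (cases "i = 0")
    case True
    then show ?thesis using assms by (simp add: partition_0)
  next
    case False
    then have "j \<le> l i \<longleftrightarrow> j \<le> m i" if "1 \<le> j" for j
      using assms that conj_part_iff[of l i j] conj_part_iff[of m i j] by simp
    from this[of "l i"] this[of "m i"] show ?thesis by (cases "l i"; cases "m i") auto
  qed
qed

lemma image_perm_support:
  assumes "w \<in> S_inf"
  shows "{i. 1 \<le> i \<and> P (inv w i)} = w ` {i. 1 \<le> i \<and> P i}" (is "?L = ?R")
proof -
  have b: "bij w" and w0: "w 0 = 0" using assms by (simp_all add: S_inf_bij S_inf_0)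
  have inv0: "inv w 0 = 0" using b w0 by (metis bij_is_inj inv_f_f)
  have ww: "w (inv w i) = i" "inv w (w i) = i" for i
    using b by (simp_all add: bij_is_inj bij_is_surj surj_f_inv_f)
  have pos: "1 \<le> w i \<longleftrightarrow> 1 \<le> i" for i using w0 inv0 ww
    by (metis less_one linorder_not_less)
  show ?thesis
  proof
    show "?R \<subseteq> ?L" using pos ww by auto
    show "?L \<subseteq> ?R"
    proof
      fix i assume "i \<in> ?L"
      then have "inv w i \<in> {i. 1 \<le> i \<and> P i}" using pos[of "inv w i"] ww(1) by simp
      then show "i \<in> ?R" by (metis ww(1) image_eqI)
    qed
  qed
qed

lemma conj_part_perm_act:
  assumes "w \<in> S_inf"
  shows "conj_part (perm_act w l) = conj_part l"
proof -
  have "card {i. 1 \<le> i \<and> j \<le> l (inv w i)} = card {i. 1 \<le> i \<and> j \<le> l i}" for j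
    unfolding image_perm_support[OF assms, of "\<lambda>i. j \<le> l i"]
    by (rule card_image) (meson S_inf_bij[OF assms] bij_is_inj inj_on_subset subset_UNIV)
  then show ?thesis by (auto simp: conj_part_def perm_act_def fun_eq_iff)
qed

text \<open>
  Rearranging a sequence does not change how many entries are at least \<open>j\<close>, and these
  numbers determine a partition.
\<close>

lemma sort_part_perm_act:
  assumes "is_partition l" "w \<in> S_inf"
  shows "sort_part (perm_act w l) = l"
  unfolding sort_part_def
proof (rule the_equality)
  show "is_partition l \<and> (\<exists>v\<in>S_inf. perm_act w l = perm_act v l)" using assms by blast
next
  fix m assume m: "is_partition m \<and> (\<exists>v\<in>S_inf. perm_act w l = perm_act v m)"
  then have "conj_part m = conj_part l" using conj_part_perm_act assms(2) by metis
  then show "m = l" using m assms(1) partition_eqI by metis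
qed

lemma weak_composition_perm_act:
  assumes "weak_composition l" "w \<in> S_inf"
  shows "weak_composition (perm_act w l)"
proof -
  have b: "bij w" and w0: "w 0 = 0" using assms by (simp_all add: S_inf_bij S_inf_0)
  have "inv w 0 = 0" using b w0 by (metis bij_is_inj inv_f_f)
  then have 0: "perm_act w l 0 = 0" using assms(1) by (simp add: perm_act_def weak_composition_def)
  then have "{i. perm_act w l i \<noteq> 0} = {i. 1 \<le> i \<and> l (inv w i) \<noteq> 0}"
    by (auto simp: perm_act_def Suc_le_eq intro!: gr0I)
  also have "\<dots> = w ` {i. 1 \<le> i \<and> l i \<noteq> 0}" by (rule image_perm_support[OF assms(2)])
  finally show ?thesis using 0 assms(1) by (simp add: weak_composition_def)
qed

lemma perm_act_comp_sref:
  assumes "w \<in> S_inf" "l i = l (Suc i)"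
  shows "perm_act (w \<circ> sref i) l = perm_act w l"
proof -
  have s: "l (sref i k) = l k" for k using assms(2) by (auto simp: sref_def transpose_def)
  have "inv (w \<circ> sref i) = sref i \<circ> inv w"
    unfolding o_inv_distrib[OF S_inf_bij[OF assms(1)] bij_sref] by (simp only: sref_def inv_transpose_eq)
  then have "inv (w \<circ> sref i) k = sref i (inv w k)" for k by (simp only: o_apply)
  then show ?thesis unfolding perm_act_def by (simp only: s)
qed

section \<open>Minimal coset representatives\<close>

text \<open>
  For a partition \<open>l\<close>, these are the minimal-length representatives of the left
  cosets of the stabiliser of \<open>l\<close>. Only adjacent positions are compared because this
  is the form in which descents arise; it extends to whole blocks of equal parts
  (\<open>min_coset_rep_increasing\<close>).
\<close>

definition min_coset_rep :: "(nat \<Rightarrow> nat) \<Rightarrow> (nat \<Rightarrow> nat) \<Rightarrow> bool" where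
  "min_coset_rep l w \<longleftrightarrow> w \<in> S_inf \<and> (\<forall>i\<ge>1. l i = l (Suc i) \<longrightarrow> w i < w (Suc i))"

lemma min_coset_rep_increasing:
  assumes "is_partition l" "min_coset_rep l w" "1 \<le> i"
  shows "i < j \<Longrightarrow> l i = l j \<Longrightarrow> w i < w j"
proof (induction j)
  case (Suc j)
  have ij: "i \<le> j" "1 \<le> j" using Suc.prems(1) assms(3) by simp_all
  have "l j \<le> l i" "l (Suc j) \<le> l j"
    using ij assms(3) partition_antimono[OF assms(1)] by simp_all
  then have eq: "l i = l j" "l j = l (Suc j)" using Suc.prems(2) by linarith+
  have step: "w j < w (Suc j)" using assms(2) ij(2) eq(2) by (simp add: min_coset_rep_def)
  show ?case
  proof (cases "i = j")
    case False
    then have "w i < w j" using Suc.IH ij(1) eq(1) by simp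
    then show ?thesis using step by simp
  qed (use step in simp)
qed simp

text \<open>
  Consider the first position \<open>i\<close> where \<open>v\<close> and \<open>w\<close> may
  differ. Were \<open>w i < v i\<close>, the position \<open>j\<close> that \<open>v\<close> sends
  to \<open>w i\<close> would lie in the block of \<open>i\<close>, and before \<open>i\<close>
  since \<open>v\<close> is increasing on that block; but there \<open>v\<close> and
  \<open>w\<close> agree, against injectivity of \<open>w\<close>.
\<close>

lemma min_coset_rep_le_witness:
  assumes "is_partition l" and v: "min_coset_rep l v" and w: "w \<in> S_inf"
    and eq: "perm_act v l = perm_act w l" and agree: "\<And>k. k < i \<Longrightarrow> v k = w k"
  shows "v i \<le> w i"
proof (rule ccontr)
  assume "\<not> v i \<le> w i"
  then have lt: "w i < v i" by simp
  have bv: "bij v" and bw: "bij w" using v w by (simp_all add: S_inf_bij min_coset_rep_def)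
  have v0: "v 0 = 0" and w0: "w 0 = 0" using v w by (simp_all add: S_inf_0 min_coset_rep_def)
  define j where "j = inv v (w i)"
  have vj: "v j = w i" using bv by (simp add: j_def bij_is_surj surj_f_inv_f)
  have "l j = l i"
    using fun_cong[OF eq, of "w i"] bw by (simp add: perm_act_def j_def bij_is_inj)
  have "1 \<le> i" using lt v0 w0 by (cases i) auto
  moreover have "j \<noteq> i" using vj lt by auto
  moreover have "\<not> i < j"
    using min_coset_rep_increasing[OF assms(1) v \<open>1 \<le> i\<close>, of j] \<open>l j = l i\<close> vj lt by auto
  ultimately have "j < i" by simp
  then have "w j = w i" using agree vj by simp
  then show False using \<open>j < i\<close> bw by (simp add: bij_is_inj inj_eq)
qed

lemma min_coset_rep_unique:
  assumes l: "is_partition l" and v: "min_coset_rep l v" and w: "min_coset_rep l w"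
    and eq: "perm_act v l = perm_act w l"
  shows "v = w"
proof
  have vS: "v \<in> S_inf" "w \<in> S_inf" using v w by (simp_all add: min_coset_rep_def)
  fix i
  show "v i = w i"
  proof (induction i rule: less_induct)
    case (less i)
    then show ?case
      using min_coset_rep_le_witness[OF l v vS(2) eq] min_coset_rep_le_witness[OF l w vS(1) eq[symmetric]]
      by (metis order_antisym)
  qed
qed

text \<open>
  A descent of the shortest permutation inside a block of equal parts could be removed without
  changing the image of \<open>l\<close>. So the shortest permutation is increasing on blocks, and
  there is only one such permutation.
\<close>

lemma min_perm_perm_act:
  assumes l: "is_partition l" and w: "min_coset_rep l w"
  shows "min_perm (perm_act w l) = w"
proof -
  let ?\<alpha> = "perm_act w l" and ?P = "\<lambda>u. u \<in> S_inf \<and> perm_act w l = perm_act u l"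
  have wS: "w \<in> S_inf" using w by (simp add: min_coset_rep_def)
  have mp: "min_perm ?\<alpha> = arg_min perm_length ?P"
    by (simp add: min_perm_def sort_part_perm_act[OF l wS])
  let ?u = "min_perm ?\<alpha>"
  have u: "?P ?u" unfolding mp by (rule arg_min_natI[of _ w]) (use wS in simp)
  have least: "perm_length ?u \<le> perm_length v" if "?P v" for v
    unfolding mp by (rule arg_min_nat_le[of ?P, OF that])
  have "min_coset_rep l ?u" unfolding min_coset_rep_def
  proof (intro conjI allI impI)
    show "?u \<in> S_inf" using u by simp
    fix i assume i: "1 \<le> i" "l i = l (Suc i)"
    show "?u i < ?u (Suc i)"
    proof (rule ccontr)
      assume "\<not> ?u i < ?u (Suc i)"
      moreover have "?u i \<noteq> ?u (Suc i)" using S_inf_bij[of ?u] u by (simp add: bij_is_inj inj_eq)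
      ultimately have "?u (Suc i) < ?u i" by simp
      from perm_length_descent[OF conjunct1[OF u] i(1) this]
      have "perm_length (?u \<circ> sref i) < perm_length ?u" by simp
      moreover have "?P (?u \<circ> sref i)"
        using u i S_inf_comp_sref[of ?u i] perm_act_comp_sref[of ?u l i] by simp
      ultimately show False using least by force
    qed
  qed
  then show ?thesis using min_coset_rep_unique[OF l _ w] u by metis
qed

section \<open>Removing descents inside a block of equal parts\<close>

interpretation pi: braid_operators pi_op
  by unfold_locales (rule pi_op_commute, assumption, rule pi_op_braid)

interpretation pibar: braid_operators pibar_op
  by unfold_locales (rule pibar_op_commute, assumption, rule pibar_op_braid)

lemma pi_perm_eq_act: "pi_perm w f = pi.act w f"
  by (simp add: pi_perm_def pi.act_def)

lemma pibar_perm_eq_act: "pibar_perm w f = pibar.act w f"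
  by (simp add: pibar_perm_def pibar.act_def)

lemma ex_descent:
  assumes "w \<in> S_inf" "\<not> min_coset_rep l w"
  obtains i where "1 \<le> i" "l i = l (Suc i)" "w (Suc i) < w i"
proof -
  obtain i where i: "1 \<le> i" "l i = l (Suc i)" "\<not> w i < w (Suc i)"
    using assms by (auto simp: min_coset_rep_def)
  moreover have "w i \<noteq> w (Suc i)" using S_inf_bij[OF assms(1)] by (simp add: bij_is_inj inj_eq)
  ultimately show ?thesis using that by simp
qed

text \<open>
  Each removed descent shortens \<open>w\<close> and contributes a factor \<open>pi_op i\<close>
  that acts trivially on \<open>f\<close>.
\<close>

lemma pi_perm_min_perm:
  assumes l: "is_partition l"
    and inv: "\<And>i. 1 \<le> i \<Longrightarrow> l i = l (Suc i) \<Longrightarrow> perm_poly (sref i) f = f"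
    and w: "w \<in> S_inf"
  shows "pi_perm w f = pi_perm (min_perm (perm_act w l)) f"
  using w
proof (induction "perm_length w" arbitrary: w rule: less_induct)
  case less
  show ?case
  proof (cases "min_coset_rep l w")
    case True
    then show ?thesis using min_perm_perm_act[OF l] by simp
  next
    case False
    then obtain i where i: "1 \<le> i" "l i = l (Suc i)" "w (Suc i) < w i"
      using ex_descent less.prems by blast
    have "pi_perm w f = pi_perm (w \<circ> sref i) (pi_op i f)"
      unfolding pi_perm_eq_act by (rule pi.act_descent[OF less.prems i(1,3)])
    also have "\<dots> = pi_perm (w \<circ> sref i) f" using inv[OF i(1,2)] by (simp add: pi_op_invariant)
    also have "\<dots> = pi_perm (min_perm (perm_act (w \<circ> sref i) l)) f"
      using perm_length_descent[OF less.prems i(1,3)] S_inf_comp_sref[OF less.prems i(1)]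
      by (intro less.hyps) simp_all
    also have "perm_act (w \<circ> sref i) l = perm_act w l"
      by (rule perm_act_comp_sref[OF less.prems i(2)])
    finally show ?thesis .
  qed
qed

lemma pibar_perm_0: "pibar_perm w 0 = 0"
proof -
  have "pi_op i 0 = 0" for i by (rule pi_op_eqI) (simp add: perm_poly_def map_key_zero[OF inj_map_key[OF bij_sref]])
  then have "foldr pibar_op a 0 = 0" for a by (induction a) (simp_all add: pibar_op_def)
  then show ?thesis by (simp add: pibar_perm_def)
qed

text \<open>
  A descent inside a block of equal parts would contribute the factor \<open>pibar_op i\<close>,
  which annihilates \<open>f\<close>.
\<close>

lemma pibar_perm_min_perm:
  assumes l: "is_partition l"
    and inv: "\<And>i. 1 \<le> i \<Longrightarrow> l i = l (Suc i) \<Longrightarrow> perm_poly (sref i) f = f"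
    and w: "w \<in> S_inf" and nz: "pibar_perm w f \<noteq> 0"
  shows "min_perm (perm_act w l) = w"
proof (cases "min_coset_rep l w")
  case True
  then show ?thesis by (rule min_perm_perm_act[OF l])
next
  case False
  then obtain i where i: "1 \<le> i" "l i = l (Suc i)" "w (Suc i) < w i"
    using ex_descent w by blast
  have "pibar_perm w f = pibar_perm (w \<circ> sref i) (pibar_op i f)"
    unfolding pibar_perm_eq_act by (rule pibar.act_descent[OF w i(1,3)])
  also have "pibar_op i f = 0" using inv[OF i(1,2)] by (simp add: pibar_op_def pi_op_invariant)
  finally show ?thesis using nz pibar_perm_0 by simp
qed

section \<open>Half of a symmetric diagram\<close>

lemma symmetric_partition_diagram:
  assumes "symmetric_partition l"
  shows "(i, j) \<in> diagram l \<longleftrightarrow> (j, i) \<in> diagram l"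
proof (cases "1 \<le> i \<and> 1 \<le> j")
  case True
  then show ?thesis using assms conj_part_iff[of l i j]
    by (auto simp: symmetric_partition_def diagram_def)
qed (auto simp: diagram_def)

lemma sref_diagram:
  assumes "symmetric_partition l" "1 \<le> t" "l t = l (Suc t)" "(i, j) \<in> diagram l"
  shows "(sref t i, sref t j) \<in> diagram l"
proof -
  have row: "(sref t i, j) \<in> diagram l" if "(i, j) \<in> diagram l" for i j
    using that assms(2,3) by (auto simp: diagram_def sref_def transpose_def)
  then show ?thesis using assms(4) symmetric_partition_diagram[OF assms(1)] by metis
qed

text \<open>
  For \<open>r\<close> one of \<open>(\<le>)\<close> and \<open>(<)\<close>, the set
  \<open>E\<close> is the half of the diagram with or without the diagonal. Exchanging the indices
  \<open>t\<close> and \<open>Suc t\<close> may throw a cell across the diagonal; reflecting it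
  back gives an involution of \<open>E\<close>, and \<open>X i + X j\<close> is unaffected by the
  reflection.
\<close>

lemma half_diagram_prod_invariant:
  assumes l: "symmetric_partition l" "1 \<le> t" "l t = l (Suc t)"
    and r: "\<And>i j. r i j \<Longrightarrow> i \<le> j"
      "\<And>i j. r i j \<Longrightarrow> r (min (sref t i) (sref t j)) (max (sref t i) (sref t j))"
  defines "E \<equiv> {(i, j). (i, j) \<in> diagram l \<and> r i j}"
  shows "perm_poly (sref t) (\<Prod>(i, j)\<in>E. X i + X j) = (\<Prod>(i, j)\<in>E. X i + X j)"
proof -
  let ?\<phi> = "\<lambda>(i, j). (min (sref t i) (sref t j), max (sref t i) (sref t j))"
  have \<phi>: "?\<phi> p \<in> E" if "p \<in> E" for p
  proof -
    obtain i j where ij: "p = (i, j)" by (cases p)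
    then have p: "p = (i, j)" "(i, j) \<in> diagram l" "r i j"
      using that by (simp_all add: E_def)
    have "(sref t i, sref t j) \<in> diagram l" using sref_diagram[OF l] p(2) by simp
    then have "(min (sref t i) (sref t j), max (sref t i) (sref t j)) \<in> diagram l"
      using symmetric_partition_diagram[OF l(1)] by (auto simp: min_def max_def)
    then show ?thesis using p r(2) by (simp add: E_def)
  qed
  have \<phi>\<phi>: "?\<phi> (?\<phi> p) = p" if "p \<in> E" for p
    using that r(1)[of "fst p" "snd p"] by (auto simp: E_def min_def max_def)
  have "perm_poly (sref t) (\<Prod>(i, j)\<in>E. X i + X j) = (\<Prod>(i, j)\<in>E. X (sref t i) + X (sref t j))"
    by (simp add: perm_poly_prod case_prod_unfold)
  also have "\<dots> = (\<Prod>(i, j)\<in>E. X i + X j)"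
    by (rule prod.reindex_bij_witness[of _ ?\<phi> ?\<phi>]) (use \<phi> \<phi>\<phi> in \<open>auto simp: min_def max_def add.commute\<close>)
  finally show ?thesis .
qed

lemma q_poly_invariant:
  assumes l: "symmetric_partition l" "1 \<le> t" "l t = l (Suc t)"
    and mu: "\<And>i. 1 \<le> i \<Longrightarrow> \<mu> i = l i - (i - 1)"
  shows "perm_poly (sref t) (q_poly \<mu>) = q_poly \<mu>"
proof -
  have "q_poly \<mu> = (\<Prod>(i, j)\<in>{(i, j). (i, j) \<in> diagram l \<and> i \<le> j}. X i + X j)"
    unfolding q_poly_def
    by (rule prod.reindex_bij_witness[of _ "\<lambda>(i, j). (i, j - i + 1)" "\<lambda>(i, j). (i, i + j - 1)"])
      (auto simp: diagram_def mu)
  then show ?thesis using half_diagram_prod_invariant[OF l, of "(\<le>)"] by simp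
qed

lemma p_poly_invariant:
  assumes l: "symmetric_partition l" "1 \<le> t" "l t = l (Suc t)"
    and mu: "\<And>i. 1 \<le> i \<Longrightarrow> \<mu> i = l i - i"
  shows "perm_poly (sref t) (p_poly \<mu>) = p_poly \<mu>"
proof -
  have inj: "sref t i = sref t j \<Longrightarrow> i = j" for i j by (metis sref_sref)
  have "p_poly \<mu> = (\<Prod>(i, j)\<in>{(i, j). (i, j) \<in> diagram l \<and> i < j}. X i + X j)"
    unfolding p_poly_def
    by (rule prod.reindex_bij_witness[of _ "\<lambda>(i, j). (i, j - i)" "\<lambda>(i, j). (i, i + j)"])
      (auto simp: diagram_def mu)
  moreover have "min (sref t i) (sref t j) < max (sref t i) (sref t j)" if "i < j" for i j
    using inj[of i j] that by (cases "sref t i = sref t j") (auto simp: min_def max_def)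
  ultimately show ?thesis using half_diagram_prod_invariant[OF l, of "(<)"] by simp
qed

section \<open>Strict partitions as halves of symmetric partitions\<close>

text \<open>
  Since the parts are distinct, column lengths can be read off from the set of parts alone; hence
  this set determines a strict partition.
\<close>

lemma conj_part_strict:
  assumes "strict_partition \<mu>" "1 \<le> j"
  shows "conj_part \<mu> j = card {a \<in> {\<mu> i | i. \<mu> i \<noteq> 0}. j \<le> a}"
proof -
  have "{a \<in> {\<mu> i | i. \<mu> i \<noteq> 0}. j \<le> a} = \<mu> ` {i. 1 \<le> i \<and> j \<le> \<mu> i}"
    using assms(2) partition_0[of \<mu>] assms(1) unfolding strict_partition_def
    by (auto simp: image_def Suc_le_eq) (metis gr0I le_zero_eq not_less_zero)
  moreover have "inj_on \<mu> {i. 1 \<le> i \<and> j \<le> \<mu> i}"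
  proof (rule inj_on_subset)
    show "inj_on \<mu> {i. \<mu> i \<noteq> 0}" using assms(1) by (simp add: strict_partition_def)
    show "{i. 1 \<le> i \<and> j \<le> \<mu> i} \<subseteq> {i. \<mu> i \<noteq> 0}" using assms(2) by auto
  qed
  ultimately show ?thesis using assms(2) by (simp add: card_image conj_part_def)
qed

lemma strict_partition_eqI:
  assumes "strict_partition \<mu>" "strict_partition \<nu>"
    "{\<mu> i | i. \<mu> i \<noteq> 0} = {\<nu> i | i. \<nu> i \<noteq> 0}"
  shows "\<mu> = \<nu>"
  using assms by (intro partition_eqI) (simp_all add: conj_part_strict, auto simp: strict_partition_def)

lemma strict_partition_parts:
  assumes "strict_partition \<mu>" "\<And>i. 1 \<le> i \<Longrightarrow> \<mu> i = g i"
  shows "{\<mu> i | i. \<mu> i \<noteq> 0} = {g i | i. 1 \<le> i} \<inter> {1..}"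
proof -
  have "\<mu> 0 = 0" using assms(1) by (simp add: strict_partition_def partition_0)
  then have pos: "1 \<le> i" if "\<mu> i \<noteq> 0" for i using that by (cases i) auto
  show ?thesis
  proof
    show "{\<mu> i | i. \<mu> i \<noteq> 0} \<subseteq> {g i | i. 1 \<le> i} \<inter> {1..}" using pos assms(2) by fastforce
    show "{g i | i. 1 \<le> i} \<inter> {1..} \<subseteq> {\<mu> i | i. \<mu> i \<noteq> 0}"
    proof
      fix a assume "a \<in> {g i | i. 1 \<le> i} \<inter> {1..}"
      then obtain i where "a = g i" "1 \<le> i" "a \<noteq> 0" by auto
      then have "a = \<mu> i" "\<mu> i \<noteq> 0" using assms(2) by simp_all
      then show "a \<in> {\<mu> i | i. \<mu> i \<noteq> 0}" by blast
    qed
  qed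
qed

lemma strict_partition_the_parts:
  assumes "strict_partition \<mu>" "\<And>i. 1 \<le> i \<Longrightarrow> \<mu> i = g i"
  shows "(THE \<nu>. strict_partition \<nu> \<and> {\<nu> i | i. \<nu> i \<noteq> 0} = {g i | i. 1 \<le> i} \<inter> {1..}) = \<mu>"
proof (rule the_equality)
  note parts = strict_partition_parts[OF assms]
  show "strict_partition \<mu> \<and> {\<mu> i | i. \<mu> i \<noteq> 0} = {g i | i. 1 \<le> i} \<inter> {1..}"
    using assms(1) parts by (rule conjI)
  fix \<nu> assume \<nu>: "strict_partition \<nu> \<and> {\<nu> i | i. \<nu> i \<noteq> 0} = {g i | i. 1 \<le> i} \<inter> {1..}"
  show "\<nu> = \<mu>"
    by (rule strict_partition_eqI[OF conjunct1[OF \<nu>] assms(1) trans[OF conjunct2[OF \<nu>] parts[symmetric]]])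
qed

lemma half_le_eqI:
  "strict_partition \<mu> \<Longrightarrow> (\<And>i. 1 \<le> i \<Longrightarrow> \<mu> i = l i - (i - 1)) \<Longrightarrow> half_le l = \<mu>"
  unfolding half_le_def by (rule strict_partition_the_parts)

lemma half_less_eqI:
  "strict_partition \<mu> \<Longrightarrow> (\<And>i. 1 \<le> i \<Longrightarrow> \<mu> i = l i - i) \<Longrightarrow> half_less l = \<mu>"
  unfolding half_less_def by (rule strict_partition_the_parts)

text \<open>
  The relation \<open>R\<close> describes the cells of the diagram to be built. By its symmetry,
  being closed to the left already implies being closed upwards and that rows and columns have
  equal lengths.
\<close>

lemma ex_symmetric_partition_of_relation:
  fixes R :: "nat \<Rightarrow> nat \<Rightarrow> bool"
  assumes R_sym: "\<And>i j. R i j \<Longrightarrow> R j i"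
    and down: "\<And>i j. 1 \<le> i \<Longrightarrow> 1 \<le> j \<Longrightarrow> R i (Suc j) \<Longrightarrow> R i j"
    and bound: "\<And>i j. 1 \<le> i \<Longrightarrow> 1 \<le> j \<Longrightarrow> R i j \<Longrightarrow> j \<le> N"
  shows "\<exists>l. symmetric_partition l \<and> (\<forall>i\<ge>1. \<forall>j\<ge>1. j \<le> l i \<longleftrightarrow> R i j)"
proof -
  define l where "l i = (if i = 0 then 0 else card {j. 1 \<le> j \<and> R i j})" for i
  have fin: "finite {j. 1 \<le> j \<and> R i j}" if "1 \<le> i" for i
    by (rule finite_subset[of _ "{..N}"]) (use bound that in auto)
  have l: "j \<le> l i \<longleftrightarrow> R i j" if "1 \<le> i" "1 \<le> j" for i j
  proof -
    let ?S = "{j. 1 \<le> j \<and> R i j}"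
    have "?S = {1..card ?S}"
      by (rule initial_segment_eq) (use fin[OF that(1)] down[OF that(1)] in auto)
    then have "j \<in> ?S \<longleftrightarrow> j \<in> {1..card ?S}" by (rule arg_cong)
    then show ?thesis using that by (auto simp: l_def)
  qed
  have "l (Suc i) \<le> l i" if "1 \<le> i" for i
  proof (cases "l (Suc i) = 0")
    case False
    then have "R (Suc i) (l (Suc i))" using l[of "Suc i" "l (Suc i)"] by simp
    then have "R i (l (Suc i))" using R_sym down that False by (metis One_nat_def Suc_leI not_gr0)
    then show ?thesis using l[of i "l (Suc i)"] that False by simp
  qed simp
  moreover have "finite {i. l i \<noteq> 0}"
  proof (rule finite_subset)
    show "{i. l i \<noteq> 0} \<subseteq> {..N}"
    proof
      fix i assume "i \<in> {i. l i \<noteq> 0}"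
      then have "1 \<le> i" "1 \<le> l i" by (auto simp: l_def split: if_splits)
      then have "R i 1" using l[of i 1] by simp
      then show "i \<in> {..N}" using R_sym bound[of 1 i] \<open>1 \<le> i\<close> by simp
    qed
  qed simp
  moreover have "l 0 = 0" by (simp add: l_def)
  ultimately have part: "is_partition l" by (simp add: is_partition_def weak_composition_def)
  have "conj_part l j = l j" for j
  proof (cases "j = 0")
    case False
    then have "{i. 1 \<le> i \<and> j \<le> l i} = {i. 1 \<le> i \<and> R j i}"
      using l R_sym by (intro Collect_cong) (metis One_nat_def Suc_leI not_gr0)
    then show ?thesis using False by (simp add: conj_part_def l_def)
  qed (simp add: conj_part_def l_def)
  then have "l = conj_part l" by (intro ext) (rule sym)
  then show ?thesis using part l unfolding symmetric_partition_def by blast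
qed

lemma strict_partition_Suc_less:
  assumes "strict_partition \<mu>" "1 \<le> i" "\<mu> (Suc i) \<noteq> 0"
  shows "\<mu> (Suc i) < \<mu> i"
proof -
  have le: "\<mu> (Suc i) \<le> \<mu> i" using assms by (simp add: strict_partition_def is_partition_def)
  moreover have "\<mu> i \<noteq> \<mu> (Suc i)"
  proof
    assume eq: "\<mu> i = \<mu> (Suc i)"
    have inj: "inj_on \<mu> {i. \<mu> i \<noteq> 0}" using assms(1) by (simp add: strict_partition_def)
    have "i = Suc i" by (rule inj_onD[OF inj eq]) (use eq assms(3) in simp_all)
    then show False using n_not_Suc_n by blast
  qed
  ultimately show ?thesis by simp
qed

lemma strict_partition_bounds:
  assumes "strict_partition \<mu>"
  obtains N where "\<And>i. \<mu> i \<noteq> 0 \<Longrightarrow> i \<le> N" "\<And>i. \<mu> i \<le> N"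
proof -
  have \<mu>: "is_partition \<mu>" using assms by (simp add: strict_partition_def)
  then have "finite {i. \<mu> i \<noteq> 0}" by (simp add: is_partition_def weak_composition_def)
  then obtain K where K: "\<And>i. \<mu> i \<noteq> 0 \<Longrightarrow> i \<le> K" by (auto simp: finite_nat_set_iff_bounded_le)
  have "\<mu> i \<le> \<mu> 1" for i
    using partition_antimono[OF \<mu>, of 1 i] partition_0[OF \<mu>] by (cases i) auto
  then show ?thesis using that[of "max K (\<mu> 1)"] K by (meson max.coboundedI1 max.coboundedI2)
qed

text \<open>
  The diagram is \<open>\<mu>\<close>, shifted so that row \<open>i\<close> starts at the diagonal
  cell \<open>(i, i)\<close>, together with its reflection. Below the diagonal the rows are closed
  to the left exactly because the nonzero parts of \<open>\<mu>\<close> decrease strictly.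
\<close>

lemma ex_symmetric_half_le:
  assumes \<mu>: "strict_partition \<mu>"
  obtains l where "symmetric_partition l" "\<And>i. 1 \<le> i \<Longrightarrow> \<mu> i = l i - (i - 1)"
proof -
  define R where "R i j \<longleftrightarrow> max i j - min i j < \<mu> (min i j)" for i j
  obtain N where N: "\<And>i. \<mu> i \<noteq> 0 \<Longrightarrow> i \<le> N" "\<And>i. \<mu> i \<le> N"
    using strict_partition_bounds[OF \<mu>] by blast
  have "\<exists>l. symmetric_partition l \<and> (\<forall>i\<ge>1. \<forall>j\<ge>1. j \<le> l i \<longleftrightarrow> R i j)"
  proof (rule ex_symmetric_partition_of_relation[of R "N + N"])
    show "R i j \<Longrightarrow> R j i" for i j by (simp add: R_def max.commute min.commute)
    show "R i j" if "1 \<le> i" "1 \<le> j" "R i (Suc j)" for i j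
    proof (cases "i \<le> j")
      case True
      then show ?thesis using that(3) by (simp add: R_def)
    next
      case False
      then have "max i (Suc j) = i" "min i (Suc j) = Suc j" by simp_all
      then have "i - Suc j < \<mu> (Suc j)" using that(3) by (simp add: R_def)
      moreover from this have "\<mu> (Suc j) < \<mu> j" using strict_partition_Suc_less[OF \<mu> that(2)] by simp
      ultimately show ?thesis using False by (simp add: R_def)
    qed
    show "j \<le> N + N" if "1 \<le> i" "1 \<le> j" "R i j" for i j
      using N(1)[of "min i j"] N(2)[of "min i j"] that(3) by (auto simp: R_def)
  qed
  then obtain l where l: "symmetric_partition l" "\<And>i j. 1 \<le> i \<Longrightarrow> 1 \<le> j \<Longrightarrow> j \<le> l i \<longleftrightarrow> R i j"
    by blast
  have "\<mu> i = l i - (i - 1)" if i: "1 \<le> i" for i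
  proof -
    have "k \<le> l i - (i - 1) \<longleftrightarrow> k \<le> \<mu> i" if "1 \<le> k" for k
    proof -
      have "k \<le> l i - (i - 1) \<longleftrightarrow> i + k - 1 \<le> l i" using i that by auto
      also have "\<dots> \<longleftrightarrow> R i (i + k - 1)" using l(2)[of i "i + k - 1"] i that by simp
      also have "\<dots> \<longleftrightarrow> k \<le> \<mu> i" using that by (auto simp: R_def max_def min_def)
      finally show ?thesis .
    qed
    from this[of "\<mu> i"] this[of "l i - (i - 1)"] show ?thesis
      by (cases "\<mu> i"; cases "l i - (i - 1)") auto
  qed
  then show ?thesis using that l(1) by blast
qed

text \<open>
  Here row \<open>i\<close> of \<open>\<mu>\<close> starts at \<open>(i, i + 1)\<close>. The
  diagonal cells in the rows of the \<open>d\<close> nonzero parts must be filled, while \<open>(d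
  + 1, d + 1)\<close> may or may not be. If \<open>d = 0\<close> or the last part \<open>\<mu>
  d\<close> is at least \<open>2\<close>, filling it would create a removable corner next to the
  addable corner \<open>(d + 1, d + 2)\<close>; if \<open>\<mu> d = 1\<close>, leaving it out
  would create an addable corner next to the removable corner \<open>(d + 1, d)\<close>. So it is
  filled exactly when \<open>d > 0\<close> and the last part is \<open>1\<close>.
\<close>

lemma ex_skew_symmetric_half_less:
  assumes \<mu>: "strict_partition \<mu>"
  obtains l where "skew_symmetric_partition l" "\<And>i. 1 \<le> i \<Longrightarrow> \<mu> i = l i - i"
proof -
  \<comment> \<open>With \<open>\<mu> 0 = 0\<close> and distinct nonzero parts, \<open>\<mu> (i - 1) = 1\<close> says that \<open>i - 1\<close> is the last nonzero row.\<close>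
  define R where "R i j \<longleftrightarrow> (if i = j then \<mu> i \<noteq> 0 \<or> \<mu> (i - 1) = 1
    else max i j - min i j \<le> \<mu> (min i j))" for i j
  have \<mu>0: "\<mu> 0 = 0" using \<mu> by (simp add: strict_partition_def partition_0)
  obtain N where N: "\<And>i. \<mu> i \<noteq> 0 \<Longrightarrow> i \<le> N" "\<And>i. \<mu> i \<le> N"
    using strict_partition_bounds[OF \<mu>] by blast
  have "\<exists>l. symmetric_partition l \<and> (\<forall>i\<ge>1. \<forall>j\<ge>1. j \<le> l i \<longleftrightarrow> R i j)"
  proof (rule ex_symmetric_partition_of_relation[of R "N + N + 1"])
    show "R i j \<Longrightarrow> R j i" for i j by (simp add: R_def max.commute min.commute split: if_splits)
    show "R i j" if "1 \<le> i" "1 \<le> j" "R i (Suc j)" for i j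
    proof -
      consider "i < j" | "i = j" | "i = Suc j" | "Suc j < i" by linarith
      then show ?thesis
      proof cases
        case 3
        then have "\<mu> (Suc j) \<noteq> 0 \<or> \<mu> j = 1" using that(3) by (simp add: R_def)
        then have "\<mu> j \<noteq> 0" using strict_partition_Suc_less[OF \<mu> that(2)] by auto
        then show ?thesis using 3 by (simp add: R_def)
      next
        case 4
        then have "i - Suc j \<le> \<mu> (Suc j)" using that(3) by (simp add: R_def)
        moreover from this have "\<mu> (Suc j) < \<mu> j"
          using 4 strict_partition_Suc_less[OF \<mu> that(2)] by simp
        ultimately show ?thesis using 4 by (simp add: R_def)
      qed (use that(3) in \<open>auto simp: R_def\<close>)
    qed
    show "j \<le> N + N + 1" if "1 \<le> i" "1 \<le> j" "R i j" for i j
    proof (cases "i = j")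
      case True
      then show ?thesis using that N(1)[of i] N(1)[of "i - 1"] by (auto simp: R_def)
    next
      case False
      then have "max i j - min i j \<le> \<mu> (min i j)" using that by (simp add: R_def)
      then show ?thesis using False N(1)[of "min i j"] N(2)[of "min i j"]
        by (cases "\<mu> (min i j) = 0") auto
    qed
  qed
  then obtain l where l: "symmetric_partition l" "\<And>i j. 1 \<le> i \<Longrightarrow> 1 \<le> j \<Longrightarrow> j \<le> l i \<longleftrightarrow> R i j"
    by blast
  have D: "(i, j) \<in> diagram l \<longleftrightarrow> 1 \<le> i \<and> 1 \<le> j \<and> R i j" for i j
    using l(2)[of i j] by (auto simp: diagram_def)
  have part: "is_partition l" using l(1) by (simp add: symmetric_partition_def)
  have "\<mu> i = l i - i" if i: "1 \<le> i" for i
  proof -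
    have "k \<le> l i - i \<longleftrightarrow> k \<le> \<mu> i" if "1 \<le> k" for k
    proof -
      have "k \<le> l i - i \<longleftrightarrow> i + k \<le> l i" using that by auto
      also have "\<dots> \<longleftrightarrow> R i (i + k)" using l(2)[of i "i + k"] i that by simp
      also have "\<dots> \<longleftrightarrow> k \<le> \<mu> i" using that by (auto simp: R_def)
      finally show ?thesis .
    qed
    from this[of "\<mu> i"] this[of "l i - i"] show ?thesis
      by (cases "\<mu> i"; cases "l i - i") auto
  qed
  moreover have "skew_symmetric_partition l"
    unfolding skew_symmetric_partition_def
  proof (intro conjI allI impI)
    show "is_partition l" by (rule part)
    show "l = conj_part l" using l(1) by (simp add: symmetric_partition_def)
    fix i :: nat assume i: "1 \<le> i"
    show "\<not> addable_corner l (i, i + 1)" if rem: "removable_corner l (i, i)"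
    proof
      assume "addable_corner l (i, i + 1)"
      then obtain \<nu> where \<nu>: "is_partition \<nu>" "diagram \<nu> = insert (i, i + 1) (diagram l)"
        and "(i, i + 1) \<notin> diagram l"
        by (auto simp: addable_corner_def)
      then have "\<mu> i = 0" using D[of i "i + 1"] i by (simp add: R_def)
      moreover have "(i, i) \<in> diagram l" using rem by (simp add: removable_corner_def)
      ultimately have 1: "\<mu> (i - 1) = 1" using D[of i i] by (simp add: R_def)
      then have "2 \<le> i" using i \<mu>0 by (cases "i = 1") auto
      then have one: "Suc 0 \<le> i - Suc 0" by simp
      have "(i, i + 1) \<in> diagram \<nu>" using \<nu>(2) by simp
      then have "(i - 1, i + 1) \<in> diagram \<nu>"
        using partition_antimono[OF \<nu>(1), of "i - 1" i] \<open>2 \<le> i\<close> one by (simp add: diagram_def)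
      then have "(i - 1, i + 1) \<in> diagram l" using \<nu>(2) \<open>2 \<le> i\<close> by auto
      then have "R (i - 1) (i + 1)" using D by blast
      moreover have "i - 1 \<noteq> i + 1" "max (i - 1) (i + 1) = i + 1" "min (i - 1) (i + 1) = i - 1"
        by simp_all
      ultimately have "i + 1 - (i - 1) \<le> \<mu> (i - 1)" unfolding R_def by (simp only: if_False)
      then show False using 1 \<open>2 \<le> i\<close> by simp
    qed
    show "\<not> removable_corner l (i, i - 1)" if add: "addable_corner l (i, i)"
    proof
      assume "removable_corner l (i, i - 1)"
      then obtain \<nu> where \<nu>: "is_partition \<nu>" "diagram \<nu> = diagram l - {(i, i - 1)}"
        and c: "(i, i - 1) \<in> diagram l"
        by (auto simp: removable_corner_def)
      have "1 \<le> i - 1" "R i (i - 1)" using c D by blast+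
      then have "2 \<le> i" by simp
      have "i \<noteq> i - 1" "max i (i - 1) = i" "min i (i - 1) = i - 1" using \<open>2 \<le> i\<close> by simp_all
      with \<open>R i (i - 1)\<close> have "i - (i - 1) \<le> \<mu> (i - 1)" unfolding R_def by (simp only: if_False)
      then have "1 \<le> \<mu> (i - 1)" using \<open>2 \<le> i\<close> by simp
      moreover have "\<mu> (i - 1) \<noteq> 1"
        using add D[of i i] i by (auto simp: addable_corner_def R_def)
      ultimately have "2 \<le> \<mu> (i - 1)" by simp
      moreover have "max (i + 1) (i - 1) = i + 1" "min (i + 1) (i - 1) = i - 1" by simp_all
      moreover have "i + 1 \<noteq> i - 1" "i + 1 - (i - 1) = 2" using \<open>2 \<le> i\<close> by simp_all
      ultimately have "R (i + 1) (i - 1)" unfolding R_def by (simp only: if_False)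
      then have "(i + 1, i - 1) \<in> diagram \<nu>" using D[of "i + 1" "i - 1"] \<open>2 \<le> i\<close> \<nu>(2) by simp
      then have "(i, i - 1) \<in> diagram \<nu>"
        using partition_antimono[OF \<nu>(1), of i "i + 1"] \<open>2 \<le> i\<close> by (simp add: diagram_def)
      then show False using \<nu>(2) by simp
    qed
  qed
  ultimately show ?thesis using that by blast
qed

section \<open>Keys and atoms indexed by weak compositions\<close>

theorem proposition2p18:
  shows "(\<forall>w\<in>S_inf. \<forall>\<mu>. strict_partition \<mu> \<longrightarrow>
           (\<exists>\<alpha>. symmetric_composition \<alpha> \<and> Q_key w \<mu> = Q_key_comp \<alpha>)) \<and>
         (\<forall>w\<in>S_inf. \<forall>\<mu>. strict_partition \<mu> \<longrightarrow> Q_atom w \<mu> \<noteq> 0 \<longrightarrow>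
           (\<exists>\<alpha>. symmetric_composition \<alpha> \<and> Q_atom w \<mu> = Q_atom_comp \<alpha>)) \<and>
         (\<forall>w\<in>S_inf. \<forall>\<mu>. strict_partition \<mu> \<longrightarrow>
           (\<exists>\<alpha>. skew_symmetric_composition \<alpha> \<and> P_key w \<mu> = P_key_comp \<alpha>)) \<and>
         (\<forall>w\<in>S_inf. \<forall>\<mu>. strict_partition \<mu> \<longrightarrow> P_atom w \<mu> \<noteq> 0 \<longrightarrow>
           (\<exists>\<alpha>. skew_symmetric_composition \<alpha> \<and> P_atom w \<mu> = P_atom_comp \<alpha>))"
proof -
  have Q: "\<exists>\<alpha>. symmetric_composition \<alpha> \<and> Q_key w \<mu> = Q_key_comp \<alpha> \<and>
      (Q_atom w \<mu> \<noteq> 0 \<longrightarrow> Q_atom w \<mu> = Q_atom_comp \<alpha>)"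
    if w: "w \<in> S_inf" and \<mu>: "strict_partition \<mu>" for w \<mu>
  proof -
    obtain l where l: "symmetric_partition l" and half: "\<And>i. 1 \<le> i \<Longrightarrow> \<mu> i = l i - (i - 1)"
      using ex_symmetric_half_le[OF \<mu>] by blast
    have part: "is_partition l" using l by (simp add: symmetric_partition_def)
    have inv: "perm_poly (sref i) (q_poly \<mu>) = q_poly \<mu>" if "1 \<le> i" "l i = l (Suc i)" for i
      using q_poly_invariant[OF l that half] .
    define \<alpha> where "\<alpha> = perm_act w l"
    have sort: "sort_part \<alpha> = l" unfolding \<alpha>_def by (rule sort_part_perm_act[OF part w])
    have hl: "half_le l = \<mu>" by (rule half_le_eqI[OF \<mu> half])
    have "symmetric_composition \<alpha>"
      using weak_composition_perm_act[OF _ w] part l sort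
      by (simp add: symmetric_composition_def is_partition_def \<alpha>_def)
    moreover have "Q_key w \<mu> = Q_key_comp \<alpha>"
      unfolding Q_key_comp_def Q_key_def sort hl unfolding \<alpha>_def
      by (rule pi_perm_min_perm[OF part inv w])
    moreover have "Q_atom w \<mu> = Q_atom_comp \<alpha>" if "Q_atom w \<mu> \<noteq> 0"
      using pibar_perm_min_perm[OF part inv w that[unfolded Q_atom_def]]
      unfolding Q_atom_comp_def sort hl unfolding \<alpha>_def by simp
    ultimately show ?thesis by blast
  qed
  have P: "\<exists>\<alpha>. skew_symmetric_composition \<alpha> \<and> P_key w \<mu> = P_key_comp \<alpha> \<and>
      (P_atom w \<mu> \<noteq> 0 \<longrightarrow> P_atom w \<mu> = P_atom_comp \<alpha>)"
    if w: "w \<in> S_inf" and \<mu>: "strict_partition \<mu>" for w \<mu>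
  proof -
    obtain l where skew: "skew_symmetric_partition l" and half: "\<And>i. 1 \<le> i \<Longrightarrow> \<mu> i = l i - i"
      using ex_skew_symmetric_half_less[OF \<mu>] by blast
    have part: "is_partition l" using skew by (simp add: skew_symmetric_partition_def)
    have l: "symmetric_partition l"
      using skew by (simp only: skew_symmetric_partition_def symmetric_partition_def)
    have inv: "perm_poly (sref i) (p_poly \<mu>) = p_poly \<mu>" if "1 \<le> i" "l i = l (Suc i)" for i
      using p_poly_invariant[OF l that half] .
    define \<alpha> where "\<alpha> = perm_act w l"
    have sort: "sort_part \<alpha> = l" unfolding \<alpha>_def by (rule sort_part_perm_act[OF part w])
    have hl: "half_less l = \<mu>" by (rule half_less_eqI[OF \<mu> half])
    have "skew_symmetric_composition \<alpha>"
      using weak_composition_perm_act[OF _ w] part skew sort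
      by (simp add: skew_symmetric_composition_def is_partition_def \<alpha>_def)
    moreover have "P_key w \<mu> = P_key_comp \<alpha>"
      unfolding P_key_comp_def P_key_def sort hl unfolding \<alpha>_def
      by (rule pi_perm_min_perm[OF part inv w])
    moreover have "P_atom w \<mu> = P_atom_comp \<alpha>" if "P_atom w \<mu> \<noteq> 0"
      using pibar_perm_min_perm[OF part inv w that[unfolded P_atom_def]]
      unfolding P_atom_comp_def sort hl unfolding \<alpha>_def by simp
    ultimately show ?thesis by blast
  qed
  show ?thesis using P Q by blast
qed

end
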